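(* Let $\xi_0,\xi_1,\xi_2,\dots$ be a $\psi$-mixing stationary process, let $\ell\ge 1$, and let $q_1,\dots,q_\ell$ be strictly increasing functions taking integer values on integers such that $$0\le q_1(n)<q_2(n)<\dots<q_\ell(n)\ \text{ for all } n\ge 0,\qquad q(n)=\min_{k\ge n}\ \min_{1\le i\le \ell-1}\bigl(q_{i+1}(k)-q_i(k)\bigr)\to\infty\ \text{ as } n\to\infty .$$ Let $\Gamma_N$, $N=1,2,\dots$, be a sequence of Borel subsets of $\mathbb{R}$ such that $$0<C^{-1}\le NQ(\Gamma_N)^\ell\le C<\infty$$ for some constant $C$. Set $$X^{(N)}_n=\prod_{i=1}^\ell\mathbb{I}_{\Gamma_N}(\xi_{q_i(n)})\quad\text{and}\quad S_N=\sum_{n=0}^{N-1}X^{(N)}_n.$$ Then $$d_{TV}\bigl(\mathcal{L}(S_N),\mathrm{Pois}(\lambda_N)\bigr)\to0\ \text{ as }N\to\infty,\qquad \lambda_N=NQ(\Gamma_N)^\ell.$$ In particular, if $\lim_{N\to\infty}NQ(\Gamma_N)^\ell=\lambda$, then the distribution of $S_N$ converges in total variation as $N\to\infty$ to the Poisson distribution with the parameter $\lambda$.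
   Context: The process $\xi_0,\xi_1,\dots$ is a stationary sequence of real random variables on a complete probability space $(\Omega,\mathcal{F},P)$. $Q$ denotes the distribution of $\xi_0$, i.e. $Q(\Gamma)=P\{\xi_0\in\Gamma\}$ for Borel $\Gamma\subset\mathbb{R}$. $\mathbb{I}_\Gamma$ is the indicator function of $\Gamma$. For $m\le n$ let $\mathcal{F}_{mn}=\sigma(\xi_m,\xi_{m+1},\dots,\xi_n)$ (and $\mathcal{F}_{m,\infty}=\sigma(\xi_m,\xi_{m+1},\dots)$). For $\sigma$-algebras $\mathcal{G},\mathcal{H}\subset\mathcal{F}$, $$\psi(\mathcal{G},\mathcal{H})=\sup_{\Gamma\in\mathcal{G},\,\Delta\in\mathcal{H}}\Bigl\{\Bigl|\frac{P(\Gamma\cap\Delta)}{P(\Gamma)P(\Delta)}-1\Bigr|:\ P(\Gamma)P(\Delta)\neq0\Bigr\},\qquad \psi(n)=\sup_{m\ge0}\psi(\mathcal{F}_{0,m},\mathcal{F}_{m+n,\infty}).$$ The process is called $\psi$-mixing if $\psi(1)<\infty$ and $\psi(n)\to0$ as $n\to\infty$. If $\ell=1$, the minimum over the empty set defining $q(n)$ is $+\infty$ (so the condition $q(n)\to\infty$ is void). $\mathcal{L}(Y)$ is the distribution of $Y$, and $d_{TV}(\mathcal{L}(Y),\mathcal{L}(Z))=\sup_G|\mathcal{L}(Y)(G)-\mathcal{L}(Z)(G)|$ with the supremum over all Borel sets $G$. $\mathrm{Pois}(\lambda)$ is the Poisson distribution with parameter $\lambda$. *)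

theory Defs
  imports "HOL-Probability.Probability"
begin

definition stationary_process :: "'a measure \<Rightarrow> (nat \<Rightarrow> 'a \<Rightarrow> real) \<Rightarrow> bool" where
  "stationary_process M \<xi> \<longleftrightarrow>
     (\<forall>n. \<xi> n \<in> borel_measurable M) \<and>
     (\<forall>k. distr M (\<Pi>\<^sub>M n\<in>UNIV. borel) (\<lambda>\<omega> n. \<xi> (n + k) \<omega>) =
          distr M (\<Pi>\<^sub>M n\<in>UNIV. borel) (\<lambda>\<omega> n. \<xi> n \<omega>))"

text \<open>The family of events of the sigma-algebra generated by the variables with index in \<open>I\<close>.\<close>

definition gen_events :: "'a measure \<Rightarrow> (nat \<Rightarrow> 'a \<Rightarrow> real) \<Rightarrow> nat set \<Rightarrow> 'a set set" where
  "gen_events M \<xi> I =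
     sigma_sets (space M) (\<Union>i\<in>I. {\<xi> i -` B \<inter> space M | B. B \<in> sets borel})"

text \<open>The dependence coefficients may be infinite, hence the values in \<^typ>\<open>ennreal\<close>.\<close>

definition psi_dep :: "'a measure \<Rightarrow> 'a set set \<Rightarrow> 'a set set \<Rightarrow> ennreal" where
  "psi_dep M \<G> \<H> =
     Sup {ennreal \<bar>measure M (A \<inter> B) / (measure M A * measure M B) - 1\<bar> | A B.
            A \<in> \<G> \<and> B \<in> \<H> \<and> measure M A * measure M B \<noteq> 0}"

definition psi_coeff :: "'a measure \<Rightarrow> (nat \<Rightarrow> 'a \<Rightarrow> real) \<Rightarrow> nat \<Rightarrow> ennreal" where
  "psi_coeff M \<xi> n = (SUP m. psi_dep M (gen_events M \<xi> {0..m}) (gen_events M \<xi> {m + n..}))"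

definition psi_mixing :: "'a measure \<Rightarrow> (nat \<Rightarrow> 'a \<Rightarrow> real) \<Rightarrow> bool" where
  "psi_mixing M \<xi> \<longleftrightarrow> psi_coeff M \<xi> 1 < \<infinity> \<and> psi_coeff M \<xi> \<longlonglongrightarrow> 0"

text \<open>For \<open>l = 1\<close> the inner infimum is over the empty set, so the value is \<open>\<infinity>\<close>.\<close>

definition min_gap :: "nat \<Rightarrow> (nat \<Rightarrow> nat \<Rightarrow> nat) \<Rightarrow> nat \<Rightarrow> enat" where
  "min_gap l q n = (INF k\<in>{n..}. INF i\<in>{1..l - 1}. enat (q (i + 1) k - q i k))"

text \<open>Total variation distance of two probability measures on the Borel sets of the real line,
  without the factor 2 used by some authors.\<close>

definition dTV :: "real measure \<Rightarrow> real measure \<Rightarrow> real" where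
  "dTV \<mu> \<nu> = (SUP G\<in>sets borel. \<bar>measure \<mu> G - measure \<nu> G\<bar>)"

definition Pois :: "real \<Rightarrow> real measure" where
  "Pois r = distr (measure_pmf (poisson_pmf r)) borel real"

definition X_prod ::
  "(nat \<Rightarrow> 'a \<Rightarrow> real) \<Rightarrow> nat \<Rightarrow> (nat \<Rightarrow> nat \<Rightarrow> nat) \<Rightarrow> real set \<Rightarrow> nat \<Rightarrow> 'a \<Rightarrow> real" where
  "X_prod \<xi> l q G n \<omega> = (\<Prod>i\<in>{1..l}. indicator G (\<xi> (q i n) \<omega>))"

definition S_sum ::
  "(nat \<Rightarrow> 'a \<Rightarrow> real) \<Rightarrow> nat \<Rightarrow> (nat \<Rightarrow> nat \<Rightarrow> nat) \<Rightarrow> (nat \<Rightarrow> real set) \<Rightarrow> nat \<Rightarrow> 'a \<Rightarrow> real" where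
  "S_sum \<xi> l q \<Gamma> N \<omega> = (\<Sum>n<N. X_prod \<xi> l q (\<Gamma> N) n \<omega>)"

end

theory Submission
  imports Defs
begin

text \<open>The sum \<open>S_sum\<close> counts how many of the events
\<open>A\<^sub>n = {\<xi>\<^bsub>q\<^sub>i(n)\<^esub> \<in> \<Gamma>\<^sub>N for all i \<le> l}\<close>, \<open>n < N\<close>, occur, and the proof is the
Chen--Stein method. Write \<open>p = Q(\<Gamma>\<^sub>N)\<close>; since \<open>N p\<^sup>l\<close> stays bounded, \<open>p\<close> tends to 0.

For every set \<open>D\<close> of naturals the equation
\<open>r f(k + 1) - k f(k) = 1\<^sub>D(k) - Pois(r)(D)\<close> has a solution with \<open>\<bar>f\<bar> \<le> exp r\<close>
(\<open>stein_sol_equation\<close>, \<open>stein_sol_bound\<close>). Hence the distance of the law of a count \<open>S\<close> from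
\<open>Pois(r)\<close> is controlled by \<open>r E f(S + 1) - E (S f(S))\<close>, uniformly in \<open>D\<close>. Expanding the second
term as a sum over the events and deleting from \<open>S\<close> the events of a neighbourhood \<open>B n\<close> of \<open>n\<close>
leaves three kinds of errors (\<open>chen_stein_bound\<close>): pairs in a common neighbourhood, the
dependence of \<open>A\<^sub>n\<close> on the count outside \<open>B n\<close>, and the difference between \<open>r\<close> and the mean. As
\<open>r\<close> remains in a bounded interval, so does the factor \<open>exp r\<close>.

The neighbourhood of \<open>n\<close> consists of those \<open>m\<close> for which some \<open>q\<^sub>j(m)\<close> is at distance less than
\<open>K\<close> from some \<open>q\<^sub>i(n)\<close>. There are at most \<open>2 K l\<^sup>2\<close> of them. Two different events \<open>A\<^sub>n\<close>, \<open>A\<^sub>m\<close>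
involve at least \<open>l + 1\<close> different indices, and finiteness of \<open>\<psi>(1)\<close> bounds the probability of
their intersection by a constant times \<open>p\<^bsup>l + 1\<^esup>\<close>, even if the indices overlap or are adjacent.
All neighbourhoods together therefore contribute \<open>O(N p\<^bsup>l + 1\<^esup>) = O(p)\<close>.

Outside the neighbourhood all indices are at distance at least \<open>K\<close> from those of \<open>n\<close>, but they lie
before, between and after them, whereas \<open>\<psi>\<close> compares only a past with a future. The
count depends only on which of finitely many \<open>\<xi>\<^sub>t\<close> lie in \<open>\<Gamma>\<^sub>N\<close>, so it suffices to treat a fixed
pattern of hits and misses. Such an event factors at every time into a past and a future
event, and since the error of \<open>\<psi>\<close>-mixing is relative to the product of the probabilities, one
far index at a time can be split off at the cost of a factor close to 1
(\<open>pattern_insert_bound\<close>, \<open>pattern_separated_bounds\<close>, \<open>occ_decoupling\<close>); relative errors survive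
summation over patterns. This requires the gaps \<open>q\<^sub>i\<^sub>+\<^sub>1(n) - q\<^sub>i(n)\<close> to be at least \<open>K\<close>, which can
fail only for the finitely many \<open>n\<close> below some \<open>n\<^sub>0\<close>. For those \<open>n\<close> every \<open>m < N\<close> is put into the
neighbourhood, which again costs only \<open>O(p)\<close>.\<close>

section \<open>The Stein equation of the Poisson distribution\<close>

text \<open>Solving the Stein equation upwards from \<open>k = 0\<close> forces this formula. The value at 0, which the
equation does not constrain, is 0 because the sum is empty.\<close>

definition stein_sol :: "real \<Rightarrow> nat set \<Rightarrow> nat \<Rightarrow> real" where
  "stein_sol r D k =
     (\<Sum>j<k. pmf (poisson_pmf r) j * (indicator D j - measure_pmf.prob (poisson_pmf r) D)) /
     (r * pmf (poisson_pmf r) (k - 1))"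

lemma stein_sol_equation:
  assumes "r > 0"
  shows "r * stein_sol r D (Suc k) - real k * stein_sol r D k =
    indicator D k - measure_pmf.prob (poisson_pmf r) D"
proof (cases k)
  case 0
  then show ?thesis using assms by (simp add: stein_sol_def)
next
  case (Suc m)
  define p where "p = pmf (poisson_pmf r)"
  define g where "g j = p j * (indicator D j - measure_pmf.prob (poisson_pmf r) D)" for j
  have "r * p m = real k * p k"
    using assms by (simp add: p_def Suc divide_simps del: of_nat_Suc)
  then have "real k * stein_sol r D k = (\<Sum>j<k. g j) / p k"
    unfolding stein_sol_def g_def[symmetric] p_def[symmetric] by (simp add: Suc del: of_nat_Suc)
  moreover have "r * stein_sol r D (Suc k) = (\<Sum>j<Suc k. g j) / p k"
    unfolding stein_sol_def g_def[symmetric] p_def[symmetric] using assms by simp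
  moreover have "p k > 0"
    using assms by (simp add: p_def)
  ultimately show ?thesis
    by (simp add: g_def add_divide_distrib)
qed

text \<open>The ratio of the two weights is \<open>r\<^bsup>i + 1\<^esup> m! / (m + 1 + i)!\<close>, and \<open>i! m!\<close> divides \<open>(i + m)!\<close>. Thus
the tail beyond \<open>m\<close>, relative to the weight at \<open>m\<close>, is dominated by the exponential series.\<close>

lemma poisson_tail_le:
  assumes "r > 0"
  shows "pmf (poisson_pmf r) (i + Suc m) \<le> r * pmf (poisson_pmf r) m * (r ^ i /\<^sub>R fact i)"
proof -
  have "fact i * fact m dvd (fact (i + m) :: nat)"
    by (rule fact_fact_dvd_fact)
  then have "fact i * fact m \<le> (fact (i + m) :: nat)"
    by (simp add: dvd_imp_le)
  also have "\<dots> \<le> fact (i + Suc m)"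
    by (intro fact_mono) auto
  finally have "real (fact i * fact m) \<le> real (fact (i + Suc m))"
    using of_nat_le_iff by blast
  then have "r ^ (i + Suc m) / fact (i + Suc m) * exp (-r) \<le> r ^ (i + Suc m) / (fact i * fact m) * exp (-r)"
    using assms by (intro mult_right_mono divide_left_mono) (auto simp del: fact_Suc add_Suc_right)
  also have "\<dots> = r * pmf (poisson_pmf r) m * (r ^ i /\<^sub>R fact i)"
    using assms by (simp add: power_add field_simps)
  also have "r ^ (i + Suc m) / fact (i + Suc m) * exp (-r) = pmf (poisson_pmf r) (i + Suc m)"
    using assms by (intro pmf_poisson[symmetric]) simp
  finally show ?thesis .
qed

text \<open>The summands in \<open>stein_sol\<close> add up to 0 over all naturals, so the partial sum is minus its tail,
and the Poisson tail is comparable with the last weight by \<open>poisson_tail_le\<close>.\<close>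

lemma stein_sol_bound:
  assumes "r > 0"
  shows "\<bar>stein_sol r D k\<bar> \<le> exp r"
proof (cases k)
  case 0
  then show ?thesis by (simp add: stein_sol_def)
next
  case (Suc m)
  define p where "p = pmf (poisson_pmf r)"
  define \<pi> where "\<pi> = measure_pmf.prob (poisson_pmf r) D"
  define g where "g j = p j * (indicator D j - \<pi>)" for j
  have sums_prob: "(\<lambda>j. indicator E j * p j) sums measure_pmf.prob (poisson_pmf r) E" for E :: "nat set"
  proof -
    have "(\<lambda>j. measure_pmf.prob (poisson_pmf r) (E \<inter> {j})) sums
        measure_pmf.prob (poisson_pmf r) (\<Union>j. E \<inter> {j})"
      by (intro measure_pmf.finite_measure_UNION) (auto simp: disjoint_family_on_def)
    moreover have "(\<Union>j. E \<inter> {j}) = E" by auto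
    moreover have "measure_pmf.prob (poisson_pmf r) (E \<inter> {j}) = indicator E j * p j" for j
      by (cases "j \<in> E") (auto simp: p_def measure_pmf_single simp del: pmf_poisson)
    ultimately show ?thesis by simp
  qed
  have p_sums: "p sums 1"
    using sums_prob[of UNIV] by simp
  have "(\<lambda>j. indicator D j * p j - \<pi> * p j) sums (\<pi> - \<pi> * 1)"
    unfolding \<pi>_def by (intro sums_diff sums_prob sums_mult p_sums)
  then have g_sums: "g sums 0"
    by (simp add: g_def[abs_def] algebra_simps)
  then have "(\<lambda>i. g (i + Suc m)) sums (0 - (\<Sum>j<Suc m. g j))"
    by (rule sums_split_initial_segment)
  then have tail: "(\<Sum>j<Suc m. g j) = - (\<Sum>i. g (i + Suc m))"
    by (simp add: sums_iff)
  have h: "\<bar>indicator D j - \<pi>\<bar> \<le> 1" for j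
  proof -
    have "0 \<le> \<pi>" "\<pi> \<le> 1" by (auto simp: \<pi>_def)
    then show ?thesis by (auto simp: indicator_def)
  qed
  have p0: "p j > 0" for j using assms by (simp add: p_def)
  have g_le: "norm (g (i + Suc m)) \<le> r * p m * (r ^ i /\<^sub>R fact i)" for i
  proof -
    have "norm (g (i + Suc m)) \<le> p (i + Suc m) * 1"
      unfolding g_def norm_mult using h p0[of "i + Suc m"] by (intro mult_mono) auto
    then show ?thesis
      using poisson_tail_le[OF assms, of i m] by (simp only: p_def mult_1_right)
  qed
  have e_sums: "(\<lambda>i. r * p m * (r ^ i /\<^sub>R fact i)) sums (r * p m * exp r)"
    by (intro sums_mult exp_converges)
  have "norm (\<Sum>i. g (i + Suc m)) \<le> (\<Sum>i. r * p m * (r ^ i /\<^sub>R fact i))"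
    by (intro norm_suminf_le g_le sums_summable[OF e_sums])
  also have "\<dots> = r * p m * exp r"
    using e_sums by (simp only: sums_iff)
  finally have "\<bar>\<Sum>j<Suc m. g j\<bar> \<le> r * p m * exp r"
    using tail by simp
  moreover have "stein_sol r D k = (\<Sum>j<Suc m. g j) / (r * p m)"
    unfolding stein_sol_def g_def \<pi>_def p_def Suc by simp
  ultimately show ?thesis
    using assms p0[of m] by (simp only: abs_divide abs_mult) (simp add: field_simps)
qed

section \<open>A Chen--Stein bound with neighbourhoods\<close>

definition hits :: "('i \<Rightarrow> 'a set) \<Rightarrow> 'i set \<Rightarrow> 'a \<Rightarrow> nat" where
  "hits A R \<omega> = card {m \<in> R. \<omega> \<in> A m}"

lemma measurable_hits:
  assumes "finite R" and "\<And>m. m \<in> R \<Longrightarrow> A m \<in> sets M"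
  shows "hits A R \<in> measurable M (count_space UNIV)"
  using assms
proof (induction R rule: finite_induct)
  case empty
  then show ?case by (simp add: hits_def[abs_def])
next
  case (insert m R)
  have "hits A (insert m R) = (\<lambda>\<omega>. if \<omega> \<in> A m then Suc (hits A R \<omega>) else hits A R \<omega>)"
  proof
    fix \<omega>
    have "{n \<in> insert m R. \<omega> \<in> A n} =
        (if \<omega> \<in> A m then insert m {n \<in> R. \<omega> \<in> A n} else {n \<in> R. \<omega> \<in> A n})"
      by auto
    then show "hits A (insert m R) \<omega> = (if \<omega> \<in> A m then Suc (hits A R \<omega>) else hits A R \<omega>)"
      using insert.hyps by (simp add: hits_def)
  qed
  moreover have "A m \<in> sets M" "hits A R \<in> measurable M (count_space UNIV)"
    using insert by auto
  ultimately show ?case by simp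
qed

lemma hits_eq_sum:
  assumes "finite R"
  shows "real (hits A R \<omega>) = (\<Sum>m\<in>R. indicator (A m) \<omega>)"
  using sum.inter_filter[OF assms, of "\<lambda>_. 1::real" "\<lambda>m. \<omega> \<in> A m"]
  by (simp add: hits_def indicator_def of_bool_def)

lemma hits_split:
  assumes "finite R" "B \<subseteq> R"
  shows "hits A R \<omega> = hits A (R - B) \<omega> + hits A B \<omega>"
proof -
  have "{m \<in> R. \<omega> \<in> A m} = {m \<in> R - B. \<omega> \<in> A m} \<union> {m \<in> B. \<omega> \<in> A m}"
    using assms by auto
  moreover have "finite B" using assms finite_subset by blast
  ultimately show ?thesis
    unfolding hits_def using assms by (simp add: card_Un_disjoint disjoint_iff)
qed

context prob_space
begin

lemma expectation_event_hits:
  assumes "finite R" "\<And>m. m \<in> R \<Longrightarrow> A m \<in> events" "E \<in> events"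
  shows "expectation (\<lambda>\<omega>. indicator E \<omega> * g (hits A R \<omega>)) =
    (\<Sum>k\<le>card R. g k * prob (E \<inter> {\<omega> \<in> space M. hits A R \<omega> = k}))"
proof -
  have [measurable]: "hits A R \<in> measurable M (count_space UNIV)" "E \<in> events"
    using assms by (auto intro: measurable_hits)
  have le: "hits A R \<omega> \<le> card R" for \<omega>
    unfolding hits_def using assms(1) by (intro card_mono) auto
  have "indicator E \<omega> * g (hits A R \<omega>) =
      (\<Sum>k\<le>card R. g k * indicator (E \<inter> {\<omega> \<in> space M. hits A R \<omega> = k}) \<omega>)"
    if "\<omega> \<in> space M" for \<omega>
  proof -
    have "(\<Sum>k\<le>card R. g k * indicator (E \<inter> {\<omega> \<in> space M. hits A R \<omega> = k}) \<omega>) =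
        (\<Sum>k\<le>card R. if k = hits A R \<omega> then indicator E \<omega> * g k else 0)"
      using that by (intro sum.cong) (auto simp: indicator_def)
    then show ?thesis using le[of \<omega>] by simp
  qed
  then have "expectation (\<lambda>\<omega>. indicator E \<omega> * g (hits A R \<omega>)) =
      expectation (\<lambda>\<omega>. \<Sum>k\<le>card R. g k * indicator (E \<inter> {\<omega> \<in> space M. hits A R \<omega> = k}) \<omega>)"
    by (intro Bochner_Integration.integral_cong) auto
  also have "\<dots> = (\<Sum>k\<le>card R. expectation (\<lambda>\<omega>. g k * indicator (E \<inter> {\<omega> \<in> space M. hits A R \<omega> = k}) \<omega>))"
    by (intro Bochner_Integration.integral_sum integrable_mult_right integrable_real_indicator)
       (auto simp: emeasure_eq_measure)
  also have "\<dots> = (\<Sum>k\<le>card R. g k * prob (E \<inter> {\<omega> \<in> space M. hits A R \<omega> = k}))"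
    by (intro sum.cong refl) simp
  finally show ?thesis .
qed

lemma abs_expectation_diff_le:
  fixes u v :: "'a \<Rightarrow> real"
  assumes "finite R" "\<And>m. m \<in> R \<Longrightarrow> A m \<in> events" "integrable M u" "integrable M v"
    and "\<And>\<omega>. \<omega> \<in> space M \<Longrightarrow> \<bar>u \<omega> - v \<omega>\<bar> \<le> c * (\<Sum>m\<in>R. indicator (A m) \<omega>)"
  shows "\<bar>expectation u - expectation v\<bar> \<le> c * (\<Sum>m\<in>R. prob (A m))"
proof -
  have int: "integrable M (\<lambda>\<omega>. \<Sum>m\<in>R. indicator (A m) \<omega> :: real)"
    using assms by (intro Bochner_Integration.integrable_sum integrable_real_indicator) (auto simp: emeasure_eq_measure)
  have "\<bar>expectation u - expectation v\<bar> = \<bar>expectation (\<lambda>\<omega>. u \<omega> - v \<omega>)\<bar>"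
    using assms by simp
  also have "\<dots> \<le> expectation (\<lambda>\<omega>. \<bar>u \<omega> - v \<omega>\<bar>)"
    by (rule integral_abs_bound)
  also have "\<dots> \<le> expectation (\<lambda>\<omega>. c * (\<Sum>m\<in>R. indicator (A m) \<omega>))"
    using assms int by (intro integral_mono) auto
  also have "\<dots> = c * expectation (\<lambda>\<omega>. (\<Sum>m\<in>R. indicator (A m) \<omega>))"
    by simp
  also have "expectation (\<lambda>\<omega>. (\<Sum>m\<in>R. indicator (A m) \<omega>)) = (\<Sum>m\<in>R. expectation (\<lambda>\<omega>. indicator (A m) \<omega> :: real))"
    using assms by (intro Bochner_Integration.integral_sum integrable_real_indicator)
       (auto simp: emeasure_eq_measure)
  also have "\<dots> = (\<Sum>m\<in>R. prob (A m))"
    using assms by (intro sum.cong) auto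
  finally show ?thesis .
qed

text \<open>On \<open>A n\<close> the full count is one plus the count outside \<open>B\<close>, unless another event of \<open>B\<close> occurs;
this gives the first sum. The count outside \<open>B\<close> is almost independent of \<open>A n\<close>, which gives
\<open>\<epsilon>\<close>. The second sum pays for replacing it by the full count again, which is wrong only if some event of
\<open>B\<close> occurs.\<close>

lemma stein_local_estimate:
  fixes A :: "'i \<Rightarrow> 'a set" and f :: "nat \<Rightarrow> real"
  assumes fin: "finite I" and ev: "\<And>m. m \<in> I \<Longrightarrow> A m \<in> events"
    and n: "n \<in> B" and B: "B \<subseteq> I"
    and dep: "\<And>k. \<bar>prob (A n \<inter> {\<omega> \<in> space M. hits A (I - B) \<omega> = k})
        - prob (A n) * prob {\<omega> \<in> space M. hits A (I - B) \<omega> = k}\<bar>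
        \<le> \<epsilon> * prob {\<omega> \<in> space M. hits A (I - B) \<omega> = k}"
    and f: "\<And>k. \<bar>f k\<bar> \<le> F"
  shows "\<bar>expectation (\<lambda>\<omega>. indicator (A n) \<omega> * f (hits A I \<omega>))
      - prob (A n) * expectation (\<lambda>\<omega>. f (Suc (hits A I \<omega>)))\<bar>
    \<le> F * (2 * (\<Sum>m\<in>B - {n}. prob (A n \<inter> A m)) + 2 * (\<Sum>m\<in>B. prob (A n) * prob (A m)) + \<epsilon>)"
proof -
  let ?R = "I - B"
  let ?E = "\<lambda>k. {\<omega> \<in> space M. hits A ?R \<omega> = k}"
  have finB: "finite B" using fin B finite_subset by blast
  have An: "A n \<in> events" using n B ev by auto
  have F0: "F \<ge> 0" using f[of 0] by linarith
  have [measurable]: "hits A I \<in> measurable M (count_space UNIV)"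
      "hits A ?R \<in> measurable M (count_space UNIV)" "A n \<in> events"
    using ev fin An by (auto intro!: measurable_hits)
  have fdiff: "\<bar>f a - f b\<bar> \<le> 2 * F" for a b
    using f[of a] f[of b] by linarith
  have int: "integrable M (\<lambda>\<omega>. f (Suc (hits A I \<omega>)))" "integrable M (\<lambda>\<omega>. f (Suc (hits A ?R \<omega>)))"
      "integrable M (\<lambda>\<omega>. indicator (A n) \<omega> * f (hits A I \<omega>))"
      "integrable M (\<lambda>\<omega>. indicator (A n) \<omega> * f (Suc (hits A ?R \<omega>)))"
    using F0 by (auto intro!: integrable_const_bound[where B = F] simp: f indicator_def)
  have step1: "\<bar>expectation (\<lambda>\<omega>. indicator (A n) \<omega> * f (hits A I \<omega>))
      - expectation (\<lambda>\<omega>. indicator (A n) \<omega> * f (Suc (hits A ?R \<omega>)))\<bar>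
      \<le> 2 * F * (\<Sum>m\<in>B - {n}. prob (A n \<inter> A m))"
  proof (rule abs_expectation_diff_le)
    fix \<omega>
    show "\<bar>indicator (A n) \<omega> * f (hits A I \<omega>) - indicator (A n) \<omega> * f (Suc (hits A ?R \<omega>))\<bar>
        \<le> 2 * F * (\<Sum>m\<in>B - {n}. indicator (A n \<inter> A m) \<omega>)"
    proof (cases "\<omega> \<in> A n \<and> (\<exists>m\<in>B - {n}. \<omega> \<in> A m)")
      case True
      then obtain m where m: "m \<in> B - {n}" "\<omega> \<in> A n \<inter> A m" by auto
      have "(1::real) \<le> (\<Sum>m\<in>B - {n}. indicator (A n \<inter> A m) \<omega>)"
        using member_le_sum[of m "B - {n}" "\<lambda>m. indicator (A n \<inter> A m) \<omega> :: real"] m finB by auto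
      then have "2 * F * 1 \<le> 2 * F * (\<Sum>m\<in>B - {n}. indicator (A n \<inter> A m) \<omega>)"
        using F0 by (intro mult_left_mono) auto
      then show ?thesis
        using fdiff[of "hits A I \<omega>" "Suc (hits A ?R \<omega>)"] m by simp
    next
      case False
      have "hits A I \<omega> = Suc (hits A ?R \<omega>)" if "\<omega> \<in> A n"
      proof -
        have "{m \<in> B. \<omega> \<in> A m} = {n}" using False that n by auto
        then have "hits A B \<omega> = 1" by (simp add: hits_def)
        then show ?thesis using hits_split[OF fin B, of A \<omega>] by simp
      qed
      then show ?thesis using F0 by (auto simp: indicator_def intro!: mult_nonneg_nonneg sum_nonneg)
    qed
  qed (use finB An ev B int in auto)
  have step2: "\<bar>expectation (\<lambda>\<omega>. f (Suc (hits A I \<omega>))) - expectation (\<lambda>\<omega>. f (Suc (hits A ?R \<omega>)))\<bar>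
      \<le> 2 * F * (\<Sum>m\<in>B. prob (A m))"
  proof (rule abs_expectation_diff_le)
    fix \<omega>
    show "\<bar>f (Suc (hits A I \<omega>)) - f (Suc (hits A ?R \<omega>))\<bar> \<le> 2 * F * (\<Sum>m\<in>B. indicator (A m) \<omega>)"
    proof (cases "hits A B \<omega> = 0")
      case True
      then show ?thesis using hits_split[OF fin B, of A \<omega>] F0
        by (auto intro!: mult_nonneg_nonneg sum_nonneg)
    next
      case False
      then have "1 \<le> real (hits A B \<omega>)" by simp
      then have "2 * F * 1 \<le> 2 * F * (\<Sum>m\<in>B. indicator (A m) \<omega>)"
        unfolding hits_eq_sum[OF finB] using F0 by (intro mult_left_mono) auto
      then show ?thesis using fdiff[of "Suc (hits A I \<omega>)" "Suc (hits A ?R \<omega>)"] by simp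
    qed
  qed (use finB ev B int in auto)
  have all: "expectation (\<lambda>\<omega>. indicator (space M) \<omega> * f (Suc (hits A ?R \<omega>))) =
      (\<Sum>k\<le>card ?R. f (Suc k) * prob (space M \<inter> ?E k))"
    by (rule expectation_event_hits) (use fin ev in auto)
  have "expectation (\<lambda>\<omega>. indicator (space M) \<omega> * f (Suc (hits A ?R \<omega>))) =
      expectation (\<lambda>\<omega>. f (Suc (hits A ?R \<omega>)))"
    by (intro Bochner_Integration.integral_cong) auto
  moreover have "space M \<inter> ?E k = ?E k" for k by auto
  ultimately have ER: "expectation (\<lambda>\<omega>. f (Suc (hits A ?R \<omega>))) = (\<Sum>k\<le>card ?R. f (Suc k) * prob (?E k))"
    using all by simp
  have EAR: "expectation (\<lambda>\<omega>. indicator (A n) \<omega> * f (Suc (hits A ?R \<omega>))) =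
      (\<Sum>k\<le>card ?R. f (Suc k) * prob (A n \<inter> ?E k))"
    by (rule expectation_event_hits) (use fin ev An in auto)
  have "(\<Sum>k\<le>card ?R. prob (?E k)) = expectation (\<lambda>\<omega>. indicator (space M) \<omega> * 1)"
    using expectation_event_hits[of ?R A "space M" "\<lambda>_. 1"] fin ev
    by (simp add: Int_absorb1 Collect_conj_eq)
  then have tot: "(\<Sum>k\<le>card ?R. prob (?E k)) = 1"
    by (simp add: prob_space)
  have step3: "\<bar>expectation (\<lambda>\<omega>. indicator (A n) \<omega> * f (Suc (hits A ?R \<omega>)))
      - prob (A n) * expectation (\<lambda>\<omega>. f (Suc (hits A ?R \<omega>)))\<bar> \<le> F * \<epsilon>"
  proof -
    have "expectation (\<lambda>\<omega>. indicator (A n) \<omega> * f (Suc (hits A ?R \<omega>)))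
        - prob (A n) * expectation (\<lambda>\<omega>. f (Suc (hits A ?R \<omega>))) =
        (\<Sum>k\<le>card ?R. f (Suc k) * (prob (A n \<inter> ?E k) - prob (A n) * prob (?E k)))"
      unfolding ER EAR by (simp add: sum_distrib_left sum_subtractf algebra_simps)
    also have "\<bar>\<dots>\<bar> \<le> (\<Sum>k\<le>card ?R. \<bar>f (Suc k) * (prob (A n \<inter> ?E k) - prob (A n) * prob (?E k))\<bar>)"
      by (rule sum_abs)
    also have "\<dots> \<le> (\<Sum>k\<le>card ?R. F * (\<epsilon> * prob (?E k)))"
      unfolding abs_mult by (intro sum_mono mult_mono f dep) (use F0 in auto)
    also have "\<dots> = F * \<epsilon>"
      using tot by (simp add: mult.assoc[symmetric] sum_distrib_left[symmetric])
    finally show ?thesis .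
  qed
  have "\<bar>prob (A n) * expectation (\<lambda>\<omega>. f (Suc (hits A I \<omega>))) - prob (A n) * expectation (\<lambda>\<omega>. f (Suc (hits A ?R \<omega>)))\<bar>
      \<le> prob (A n) * (2 * F * (\<Sum>m\<in>B. prob (A m)))"
    unfolding right_diff_distrib[symmetric] abs_mult using step2 by (simp add: mult_left_mono)
  also have "\<dots> = F * (2 * (\<Sum>m\<in>B. prob (A n) * prob (A m)))"
    by (simp add: sum_distrib_left algebra_simps)
  finally have step4: "\<bar>prob (A n) * expectation (\<lambda>\<omega>. f (Suc (hits A I \<omega>))) - prob (A n) * expectation (\<lambda>\<omega>. f (Suc (hits A ?R \<omega>)))\<bar>
      \<le> F * (2 * (\<Sum>m\<in>B. prob (A n) * prob (A m)))" .
  have "F * (2 * (\<Sum>m\<in>B - {n}. prob (A n \<inter> A m)) + 2 * (\<Sum>m\<in>B. prob (A n) * prob (A m)) + \<epsilon>) =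
      2 * F * (\<Sum>m\<in>B - {n}. prob (A n \<inter> A m)) + F * (2 * (\<Sum>m\<in>B. prob (A n) * prob (A m))) + F * \<epsilon>"
    by (simp add: algebra_simps)
  then show ?thesis using step1 step3 step4 by linarith
qed

text \<open>The Stein equation turns the difference of probabilities into
\<open>r E f(S + 1) - E (S f(S))\<close> with \<open>S\<close> the number of events that occur, and \<open>S f(S)\<close> is the sum
of \<open>f(S)\<close> over those events, to each of which \<open>stein_local_estimate\<close> applies.\<close>

lemma chen_stein_bound:
  fixes A :: "'i \<Rightarrow> 'a set"
  assumes fin: "finite I" and ev: "\<And>n. n \<in> I \<Longrightarrow> A n \<in> events"
    and B: "\<And>n. n \<in> I \<Longrightarrow> B n \<subseteq> I" and self: "\<And>n. n \<in> I \<Longrightarrow> n \<in> B n"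
    and dep: "\<And>n k. n \<in> I \<Longrightarrow> \<bar>prob (A n \<inter> {\<omega> \<in> space M. hits A (I - B n) \<omega> = k})
        - prob (A n) * prob {\<omega> \<in> space M. hits A (I - B n) \<omega> = k}\<bar>
        \<le> \<epsilon> n * prob {\<omega> \<in> space M. hits A (I - B n) \<omega> = k}"
    and r: "r > 0"
  shows "\<bar>prob {\<omega> \<in> space M. hits A I \<omega> \<in> D} - measure_pmf.prob (poisson_pmf r) D\<bar>
    \<le> exp r * (2 * (\<Sum>n\<in>I. \<Sum>m\<in>B n - {n}. prob (A n \<inter> A m))
      + 2 * (\<Sum>n\<in>I. \<Sum>m\<in>B n. prob (A n) * prob (A m))
      + (\<Sum>n\<in>I. \<epsilon> n) + \<bar>(\<Sum>n\<in>I. prob (A n)) - r\<bar>)"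
proof -
  let ?\<pi> = "measure_pmf.prob (poisson_pmf r) D"
  define f where "f = stein_sol r D"
  have f: "\<bar>f k\<bar> \<le> exp r" for k
    unfolding f_def by (rule stein_sol_bound[OF r])
  have [measurable]: "hits A I \<in> measurable M (count_space UNIV)"
    using ev fin by (auto intro!: measurable_hits)
  have Am: "A n \<in> events" if "n \<in> I" for n using ev that .
  have int1: "integrable M (\<lambda>\<omega>. f (Suc (hits A I \<omega>)))"
    by (auto intro!: integrable_const_bound[where B = "exp r"] simp: f)
  have int2: "integrable M (\<lambda>\<omega>. indicator (A n) \<omega> * f (hits A I \<omega>))" if "n \<in> I" for n
    using Am[OF that] by (auto intro!: integrable_const_bound[where B = "exp r"] simp: f indicator_def)
  let ?e = "expectation (\<lambda>\<omega>. f (Suc (hits A I \<omega>)))"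
  have e: "\<bar>?e\<bar> \<le> exp r"
  proof -
    have "\<bar>?e\<bar> \<le> expectation (\<lambda>\<omega>. \<bar>f (Suc (hits A I \<omega>))\<bar>)" by (rule integral_abs_bound)
    also have "\<dots> \<le> expectation (\<lambda>_. exp r)"
      using int1 by (intro integral_mono) (auto simp: f)
    finally show ?thesis by (simp add: prob_space)
  qed
  have set: "{\<omega> \<in> space M. hits A I \<omega> \<in> D} \<in> events" by measurable
  have "prob {\<omega> \<in> space M. hits A I \<omega> \<in> D} - ?\<pi> =
      expectation (\<lambda>\<omega>. indicator {\<omega> \<in> space M. hits A I \<omega> \<in> D} \<omega> - ?\<pi>)"
    using set by (subst Bochner_Integration.integral_diff) (auto simp: prob_space emeasure_eq_measure)
  also have "\<dots> = expectation (\<lambda>\<omega>. r * f (Suc (hits A I \<omega>)) - (\<Sum>n\<in>I. indicator (A n) \<omega> * f (hits A I \<omega>)))"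
  proof (intro Bochner_Integration.integral_cong refl)
    fix \<omega> assume "\<omega> \<in> space M"
    then have "indicator {\<omega> \<in> space M. hits A I \<omega> \<in> D} \<omega> - ?\<pi> = indicator D (hits A I \<omega>) - ?\<pi>"
      by (simp add: indicator_def)
    also have "\<dots> = r * f (Suc (hits A I \<omega>)) - real (hits A I \<omega>) * f (hits A I \<omega>)"
      unfolding f_def by (rule stein_sol_equation[OF r, symmetric])
    also have "\<dots> = r * f (Suc (hits A I \<omega>)) - (\<Sum>n\<in>I. indicator (A n) \<omega> * f (hits A I \<omega>))"
      unfolding hits_eq_sum[OF fin] by (simp add: sum_distrib_right)
    finally show "indicator {\<omega> \<in> space M. hits A I \<omega> \<in> D} \<omega> - ?\<pi> =
        r * f (Suc (hits A I \<omega>)) - (\<Sum>n\<in>I. indicator (A n) \<omega> * f (hits A I \<omega>))" .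
  qed
  also have "\<dots> = r * ?e - (\<Sum>n\<in>I. expectation (\<lambda>\<omega>. indicator (A n) \<omega> * f (hits A I \<omega>)))"
    using int1 int2 by (subst Bochner_Integration.integral_diff) (auto intro!: Bochner_Integration.integrable_sum)
  also have "\<dots> = - ((\<Sum>n\<in>I. prob (A n)) - r) * ?e
      - (\<Sum>n\<in>I. expectation (\<lambda>\<omega>. indicator (A n) \<omega> * f (hits A I \<omega>)) - prob (A n) * ?e)"
    by (simp add: sum_subtractf sum_distrib_right algebra_simps)
  also have "\<bar>\<dots>\<bar> \<le> \<bar>((\<Sum>n\<in>I. prob (A n)) - r) * ?e\<bar>
      + \<bar>\<Sum>n\<in>I. expectation (\<lambda>\<omega>. indicator (A n) \<omega> * f (hits A I \<omega>)) - prob (A n) * ?e\<bar>"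
    by linarith
  also have "\<dots> \<le> exp r * \<bar>(\<Sum>n\<in>I. prob (A n)) - r\<bar>
      + (\<Sum>n\<in>I. exp r * (2 * (\<Sum>m\<in>B n - {n}. prob (A n \<inter> A m)) + 2 * (\<Sum>m\<in>B n. prob (A n) * prob (A m)) + \<epsilon> n))"
  proof (rule add_mono)
    show "\<bar>((\<Sum>n\<in>I. prob (A n)) - r) * ?e\<bar> \<le> exp r * \<bar>(\<Sum>n\<in>I. prob (A n)) - r\<bar>"
      unfolding abs_mult using e by (subst mult.commute) (rule mult_right_mono, auto)
    show "\<bar>\<Sum>n\<in>I. expectation (\<lambda>\<omega>. indicator (A n) \<omega> * f (hits A I \<omega>)) - prob (A n) * ?e\<bar> \<le>
      (\<Sum>n\<in>I. exp r * (2 * (\<Sum>m\<in>B n - {n}. prob (A n \<inter> A m)) + 2 * (\<Sum>m\<in>B n. prob (A n) * prob (A m)) + \<epsilon> n))"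
      by (rule order_trans[OF sum_abs], intro sum_mono stein_local_estimate)
         (use fin ev B self dep f in auto)
  qed
  also have "\<dots> = exp r * (2 * (\<Sum>n\<in>I. \<Sum>m\<in>B n - {n}. prob (A n \<inter> A m))
      + 2 * (\<Sum>n\<in>I. \<Sum>m\<in>B n. prob (A n) * prob (A m))
      + (\<Sum>n\<in>I. \<epsilon> n) + \<bar>(\<Sum>n\<in>I. prob (A n)) - r\<bar>)"
    by (simp add: sum.distrib sum_distrib_left algebra_simps)
  finally show ?thesis .
qed

end

section \<open>Decoupling of patterns under \<open>\<psi>\<close>-mixing\<close>

text \<open>Multiplying out the quotient in \<open>psi_dep\<close> also covers events of probability 0, where both sides
vanish.\<close>

lemma psi_coeff_product_bound:
  assumes "prob_space M" and psi: "psi_coeff M \<xi> n \<le> ennreal \<eta>" and "\<eta> \<ge> 0"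
    and E: "E \<in> gen_events M \<xi> {0..m}" "E \<in> sets M"
    and F: "F \<in> gen_events M \<xi> {m + n..}" "F \<in> sets M"
  shows "\<bar>measure M (E \<inter> F) - measure M E * measure M F\<bar> \<le> \<eta> * (measure M E * measure M F)"
proof -
  interpret prob_space M by fact
  show ?thesis
  proof (cases "prob E * prob F = 0")
    case True
    have "prob (E \<inter> F) \<le> prob E" "prob (E \<inter> F) \<le> prob F"
      using E F by (auto intro!: finite_measure_mono)
    then have "prob (E \<inter> F) = 0"
      using True measure_nonneg[of M "E \<inter> F"] by (auto simp del: measure_nonneg intro: antisym)
    then show ?thesis by (simp add: True)
  next
    case False
    have "ennreal \<bar>prob (E \<inter> F) / (prob E * prob F) - 1\<bar> \<le>
        psi_dep M (gen_events M \<xi> {0..m}) (gen_events M \<xi> {m + n..})"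
      unfolding psi_dep_def using E F False by (intro Sup_upper) blast
    also have "\<dots> \<le> psi_coeff M \<xi> n"
      unfolding psi_coeff_def by (rule SUP_upper) simp
    also have "\<dots> \<le> ennreal \<eta>" by (rule psi)
    finally have le: "\<bar>prob (E \<inter> F) / (prob E * prob F) - 1\<bar> \<le> \<eta>"
      using \<open>\<eta> \<ge> 0\<close> by (simp add: ennreal_le_iff)
    have "prob (E \<inter> F) - prob E * prob F = (prob (E \<inter> F) / (prob E * prob F) - 1) * (prob E * prob F)"
      using False by (simp add: field_simps)
    then have "\<bar>prob (E \<inter> F) - prob E * prob F\<bar> = \<bar>prob (E \<inter> F) / (prob E * prob F) - 1\<bar> * (prob E * prob F)"
      by (simp only: abs_mult) simp
    then show ?thesis using le by (simp only:) (intro mult_right_mono, auto)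
  qed
qed

text \<open>The atoms of the algebra generated by the events \<open>{\<xi> t \<in> G}\<close>, \<open>t \<in> J\<close>. The set \<open>T\<close> of hits may
extend beyond \<open>J\<close>, so that a single \<open>T\<close> serves for \<open>J\<close> and for the parts into which it is cut.\<close>

definition pattern :: "'a measure \<Rightarrow> (nat \<Rightarrow> 'a \<Rightarrow> real) \<Rightarrow> real set \<Rightarrow> nat set \<Rightarrow> nat set \<Rightarrow> 'a set" where
  "pattern M \<xi> G J T = {\<omega> \<in> space M. \<forall>t\<in>J. \<xi> t \<omega> \<in> G \<longleftrightarrow> t \<in> T}"

lemma pattern_empty [simp]: "pattern M \<xi> G {} T = space M"
  by (simp add: pattern_def)

lemma pattern_Un: "pattern M \<xi> G (J \<union> K) T = pattern M \<xi> G J T \<inter> pattern M \<xi> G K T"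
  by (auto simp: pattern_def)

lemma pattern_cong: "J \<inter> T = J \<inter> U \<Longrightarrow> pattern M \<xi> G J T = pattern M \<xi> G J U"
  by (auto simp: pattern_def)

lemma pattern_in_gen_events:
  assumes "finite J" "J \<subseteq> I" "G \<in> sets borel"
  shows "pattern M \<xi> G J T \<in> gen_events M \<xi> I"
  using assms(1,2)
proof (induction J rule: finite_induct)
  interpret sigma_algebra "space M" "gen_events M \<xi> I"
    unfolding gen_events_def by (rule sigma_algebra_sigma_sets) auto
  case empty
  show ?case by simp
next
  interpret sigma_algebra "space M" "gen_events M \<xi> I"
    unfolding gen_events_def by (rule sigma_algebra_sigma_sets) auto
  case (insert t J)
  define H where "H = (if t \<in> T then G else - G)"
  have "H \<in> sets borel" using assms(3) by (auto simp: H_def)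
  then have "\<xi> t -` H \<inter> space M \<in> gen_events M \<xi> I"
    unfolding gen_events_def using insert.prems by (intro sigma_sets.Basic) auto
  moreover have "pattern M \<xi> G (insert t J) T = (\<xi> t -` H \<inter> space M) \<inter> pattern M \<xi> G J T"
    by (auto simp: pattern_def H_def split: if_splits)
  ultimately show ?case using insert by auto
qed

lemma gen_events_subset_sets:
  assumes "\<And>n. \<xi> n \<in> borel_measurable M"
  shows "gen_events M \<xi> I \<subseteq> sets M"
  unfolding gen_events_def using assms by (intro sets.sigma_sets_subset) (auto intro: measurable_sets)

locale psi_process = prob_space M for M :: "'a measure" +
  fixes \<xi> :: "nat \<Rightarrow> 'a \<Rightarrow> real"
  assumes stationary: "stationary_process M \<xi>" and mixing: "psi_mixing M \<xi>"
begin

lemma random_variable_xi [measurable]: "\<xi> n \<in> borel_measurable M"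
  using stationary by (simp add: stationary_process_def)

lemma pattern_event [measurable]:
  "finite J \<Longrightarrow> G \<in> sets borel \<Longrightarrow> pattern M \<xi> G J T \<in> events"
  using pattern_in_gen_events[of J UNIV G M \<xi> T] gen_events_subset_sets[of \<xi> M UNIV] by auto

text \<open>The laws of \<open>\<xi> t\<close> and \<open>\<xi> 0\<close> are the first marginals of the shifted and of the original sequence.\<close>

lemma pattern_point_prob:
  assumes "G \<in> sets borel"
  shows "prob (pattern M \<xi> G {t} {t}) = measure (distr M borel (\<xi> 0)) G"
proof -
  have eq: "distr M borel (\<xi> k) = distr (distr M (\<Pi>\<^sub>M n\<in>UNIV. borel) (\<lambda>\<omega> n. \<xi> (n + k) \<omega>)) borel (\<lambda>x. x 0)" for k
    by (subst distr_distr) (auto simp: comp_def intro!: measurable_PiM_single')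
  have "distr M borel (\<xi> t) = distr M borel (\<xi> 0)"
    using stationary eq[of t] eq[of 0] by (simp add: stationary_process_def)
  moreover have "measure (distr M borel (\<xi> t)) G = prob (pattern M \<xi> G {t} {t})"
    using assms by (simp add: measure_distr pattern_def vimage_def Int_def conj_commute)
  ultimately show ?thesis by simp
qed

text \<open>If \<open>J\<close> is empty there is no last index of the past, and the first event is the whole space.\<close>

lemma past_future_bound:
  assumes "psi_coeff M \<xi> K \<le> ennreal \<eta>" "\<eta> \<ge> 0" "G \<in> sets borel"
    and "finite J" "finite L" "\<And>s t. s \<in> J \<Longrightarrow> t \<in> L \<Longrightarrow> s + K \<le> t"
  shows "\<bar>prob (pattern M \<xi> G J T \<inter> pattern M \<xi> G L T)
      - prob (pattern M \<xi> G J T) * prob (pattern M \<xi> G L T)\<bar>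
    \<le> \<eta> * (prob (pattern M \<xi> G J T) * prob (pattern M \<xi> G L T))"
proof (cases "J = {}")
  case True
  then show ?thesis
    using assms pattern_event[of L G T] by (simp add: prob_space Int_absorb1 sets.sets_into_space)
next
  case False
  have "J \<subseteq> {0..Max J}" using assms by auto
  moreover have "L \<subseteq> {Max J + K..}"
    using assms(6)[OF Max_in[OF assms(4) False]] by auto
  ultimately show ?thesis
    using assms by (intro psi_coeff_product_bound[where n = K and m = "Max J"])
      (auto intro!: pattern_in_gen_events pattern_event prob_space_axioms)
qed

text \<open>Split \<open>J\<close> at \<open>t\<close> into a past and a future with probabilities \<open>a\<close> and \<open>c\<close>. Up to factors
\<open>1 \<plusminus> \<eta>\<close>, the pattern on \<open>J\<close> has probability \<open>a c\<close> (one cut), and the pattern with \<open>t\<close> inserted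
has probability \<open>a b c\<close> (two cuts, one on each side of \<open>t\<close>). The quotient
\<open>(1 + \<eta>)\<^sup>2 / (1 - \<eta>)\<close> is at most \<open>1 + 5 \<eta>\<close> for \<open>\<eta> \<le> 1/3\<close>, and similarly from below.\<close>

lemma pattern_insert_bound:
  assumes psi: "psi_coeff M \<xi> K \<le> ennreal \<eta>" and \<eta>: "0 \<le> \<eta>" "\<eta> \<le> 1/3" and "K \<ge> 1"
    and G: "G \<in> sets borel" and J: "finite J"
    and sep: "\<And>s. s \<in> J \<Longrightarrow> s + K \<le> t \<or> t + K \<le> s" and t: "t \<in> T"
  shows "\<bar>prob (pattern M \<xi> G (insert t J) T) - prob (pattern M \<xi> G {t} {t}) * prob (pattern M \<xi> G J T)\<bar>
    \<le> 5 * \<eta> * (prob (pattern M \<xi> G {t} {t}) * prob (pattern M \<xi> G J T))"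
proof -
  define J1 where "J1 = {s\<in>J. s < t}"
  define J2 where "J2 = {s\<in>J. t < s}"
  let ?P = "\<lambda>J. pattern M \<xi> G J T"
  have "t \<notin> J" using sep[of t] \<open>K \<ge> 1\<close> by auto
  then have JU: "J = J1 \<union> J2"
    by (auto simp: J1_def J2_def) (metis nat_neq_iff)
  have fin: "finite J1" "finite J2" using J by (auto simp: J1_def J2_def)
  have sep1: "s + K \<le> t" if "s \<in> J1" for s using sep[of s] that by (auto simp: J1_def)
  have sep2: "t + K \<le> s" if "s \<in> J2" for s using sep[of s] that by (auto simp: J2_def)
  have pt: "pattern M \<xi> G {t} {t} = ?P {t}" using t by (intro pattern_cong) auto
  define a b c where "a = prob (?P J1)" and "b = prob (?P {t})" and "c = prob (?P J2)"
  have nn: "a \<ge> 0" "b \<ge> 0" "c \<ge> 0" by (simp_all add: a_def b_def c_def)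
  have b1: "\<bar>prob (?P J1 \<inter> ?P {t}) - a * b\<bar> \<le> \<eta> * (a * b)"
    unfolding a_def b_def using fin sep1 by (intro past_future_bound[OF psi]) (use \<eta> G in auto)
  have b2: "\<bar>prob (?P J1 \<inter> ?P J2) - a * c\<bar> \<le> \<eta> * (a * c)"
    unfolding a_def c_def
  proof (intro past_future_bound[OF psi] \<eta> G fin)
    fix s u assume "s \<in> J1" "u \<in> J2"
    then show "s + K \<le> u" using sep1[of s] sep2[of u] by linarith
  qed
  have b3: "\<bar>prob (?P (insert t J1) \<inter> ?P J2) - prob (?P (insert t J1)) * c\<bar> \<le> \<eta> * (prob (?P (insert t J1)) * c)"
    unfolding c_def
  proof (intro past_future_bound[OF psi] \<eta> G)
    fix s u assume "s \<in> insert t J1" "u \<in> J2"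
    then show "s + K \<le> u" using sep1[of s] sep2[of u] by auto
  qed (use fin in auto)
  have ins: "?P (insert t J1) = ?P J1 \<inter> ?P {t}"
    using pattern_Un[of M \<xi> G J1 "{t}" T] by simp
  define x where "x = prob (?P J1 \<inter> ?P {t})"
  define z where "z = a * c"
  have z0: "z \<ge> 0" using nn by (simp add: z_def)
  have x: "(1 - \<eta>) * (a * b) \<le> x" "x \<le> (1 + \<eta>) * (a * b)"
    using b1 by (simp_all add: abs_le_iff algebra_simps x_def)
  define y where "y = prob (?P J)"
  have "?P J = ?P J1 \<inter> ?P J2" unfolding JU by (rule pattern_Un)
  then have y: "(1 - \<eta>) * z \<le> y" "y \<le> (1 + \<eta>) * z"
    using b2 by (simp_all add: abs_le_iff algebra_simps y_def z_def)
  define w where "w = prob (?P (insert t J))"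
  have "?P (insert t J) = ?P (insert t J1) \<inter> ?P J2"
    unfolding JU using pattern_Un[of M \<xi> G "insert t J1" J2 T] by simp
  then have w: "(1 - \<eta>) * (x * c) \<le> w" "w \<le> (1 + \<eta>) * (x * c)"
    using b3 unfolding ins by (simp_all add: abs_le_iff algebra_simps w_def x_def)
  have "w \<le> (1 + \<eta>) * (((1 + \<eta>) * (a * b)) * c)"
    using w(2) x(2) nn \<eta> by (meson mult_left_mono mult_right_mono order_trans add_nonneg_nonneg zero_le_one)
  also have "\<dots> = ((1 + \<eta>) * (1 + \<eta>)) * (b * z)" by (simp add: z_def)
  also have "\<dots> \<le> ((1 + 5 * \<eta>) * (1 - \<eta>)) * (b * z)"
  proof (intro mult_right_mono)
    have "\<eta> * (6 * \<eta>) \<le> \<eta> * 2" using \<eta> by (intro mult_left_mono) auto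
    then show "(1 + \<eta>) * (1 + \<eta>) \<le> (1 + 5 * \<eta>) * (1 - \<eta>)" by (simp add: algebra_simps)
  qed (use nn z0 in auto)
  also have "\<dots> = (1 + 5 * \<eta>) * b * ((1 - \<eta>) * z)" by simp
  also have "\<dots> \<le> (1 + 5 * \<eta>) * b * y" using y nn \<eta> by (intro mult_left_mono) auto
  finally have up: "w \<le> (1 + 5 * \<eta>) * b * y" .
  have "w \<ge> (1 - 5 * \<eta>) * b * y"
  proof (cases "1 - 5 * \<eta> \<ge> 0")
    case True
    have "(1 - 5 * \<eta>) * b * y \<le> (1 - 5 * \<eta>) * b * ((1 + \<eta>) * z)"
      using True nn y by (intro mult_left_mono) auto
    also have "\<dots> = ((1 - 5 * \<eta>) * (1 + \<eta>)) * (b * z)" by simp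
    also have "\<dots> \<le> ((1 - \<eta>) * (1 - \<eta>)) * (b * z)"
    proof (intro mult_right_mono)
      have "0 \<le> \<eta> * \<eta>" by simp
      then show "(1 - 5 * \<eta>) * (1 + \<eta>) \<le> (1 - \<eta>) * (1 - \<eta>)" using \<eta> by (simp add: algebra_simps)
    qed (use nn z0 in auto)
    also have "\<dots> = (1 - \<eta>) * (((1 - \<eta>) * (a * b)) * c)" by (simp add: z_def)
    also have "\<dots> \<le> (1 - \<eta>) * (x * c)" using x nn \<eta> by (intro mult_left_mono mult_right_mono) auto
    also have "\<dots> \<le> w" by (rule w)
    finally show ?thesis .
  next
    case False
    have "(1 - 5 * \<eta>) * b * y \<le> 0"
      using False nn by (intro mult_nonpos_nonneg) (auto simp: y_def)
    then show ?thesis using measure_nonneg[of M "?P (insert t J)"] unfolding w_def by linarith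
  qed
  with up show ?thesis
    unfolding pt b_def[symmetric] w_def[symmetric] y_def[symmetric] by (simp add: abs_le_iff algebra_simps)
qed

text \<open>Insert the points of \<open>I\<close> one by one: those already inserted are just further points of the
pattern, as far from the next one as the points of \<open>J\<close>.\<close>

lemma pattern_separated_bounds:
  assumes psi: "psi_coeff M \<xi> K \<le> ennreal \<eta>" and \<eta>: "0 \<le> \<eta>" "5 * \<eta> \<le> 1" and K: "K \<ge> 1"
    and G: "G \<in> sets borel" and J: "finite J" and I: "finite I" "I \<subseteq> T"
    and sepJ: "\<And>s t. s \<in> J \<Longrightarrow> t \<in> I \<Longrightarrow> s + K \<le> t \<or> t + K \<le> s"
    and sepI: "\<And>s t. s \<in> I \<Longrightarrow> t \<in> I \<Longrightarrow> s < t \<Longrightarrow> s + K \<le> t"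
  defines "p \<equiv> measure (distr M borel (\<xi> 0)) G"
  shows "(1 - 5 * \<eta>) ^ card I * (p ^ card I * prob (pattern M \<xi> G J T)) \<le> prob (pattern M \<xi> G (I \<union> J) T)"
    and "prob (pattern M \<xi> G (I \<union> J) T) \<le> (1 + 5 * \<eta>) ^ card I * (p ^ card I * prob (pattern M \<xi> G J T))"
proof -
  have p0: "p \<ge> 0" by (simp add: p_def)
  let ?P = "\<lambda>J. prob (pattern M \<xi> G J T)"
  have "(1 - 5 * \<eta>) ^ card I * (p ^ card I * ?P J) \<le> ?P (I \<union> J) \<and>
      ?P (I \<union> J) \<le> (1 + 5 * \<eta>) ^ card I * (p ^ card I * ?P J)"
    using I sepJ sepI
  proof (induction I rule: finite_induct)
    case empty
    then show ?case by simp
  next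
    case (insert t I)
    have "s + K \<le> t \<or> t + K \<le> s" if "s \<in> I \<union> J" for s
    proof (cases "s \<in> J")
      case False
      then have "s \<in> I" "s \<noteq> t" using that insert.hyps by auto
      then show ?thesis using insert.prems(3)[of s t] insert.prems(3)[of t s] by (cases "s < t") auto
    qed (use insert.prems(2)[of s t] in auto)
    then have "\<bar>?P (insert t (I \<union> J)) - prob (pattern M \<xi> G {t} {t}) * ?P (I \<union> J)\<bar>
      \<le> 5 * \<eta> * (prob (pattern M \<xi> G {t} {t}) * ?P (I \<union> J))"
      using \<eta> insert J by (intro pattern_insert_bound[OF psi _ _ K G]) auto
    then have b: "(1 - 5 * \<eta>) * (p * ?P (I \<union> J)) \<le> ?P (insert t (I \<union> J))"
        "?P (insert t (I \<union> J)) \<le> (1 + 5 * \<eta>) * (p * ?P (I \<union> J))"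
      unfolding pattern_point_prob[OF G] p_def[symmetric] by (simp_all add: abs_le_iff algebra_simps)
    have IH: "(1 - 5 * \<eta>) ^ card I * (p ^ card I * ?P J) \<le> ?P (I \<union> J)"
      "?P (I \<union> J) \<le> (1 + 5 * \<eta>) ^ card I * (p ^ card I * ?P J)"
      using insert by auto
    have "(1 - 5 * \<eta>) * (p * ((1 - 5 * \<eta>) ^ card I * (p ^ card I * ?P J))) \<le> (1 - 5 * \<eta>) * (p * ?P (I \<union> J))"
      using IH(1) p0 \<eta> by (intro mult_left_mono) auto
    moreover have "(1 + 5 * \<eta>) * (p * ?P (I \<union> J)) \<le> (1 + 5 * \<eta>) * (p * ((1 + 5 * \<eta>) ^ card I * (p ^ card I * ?P J)))"
      using IH(2) p0 \<eta> by (intro mult_left_mono) auto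
    ultimately show ?case
      using b insert.hyps by (simp add: mult_ac)
  qed
  then show "(1 - 5 * \<eta>) ^ card I * (p ^ card I * ?P J) \<le> ?P (I \<union> J)"
    "?P (I \<union> J) \<le> (1 + 5 * \<eta>) ^ card I * (p ^ card I * ?P J)" by auto
qed

text \<open>Distinct integers are at distance at least 1, so splitting off the largest index costs at most
a factor \<open>1 + \<psi>(1)\<close>. This is what excludes clusters of hits at adjacent times.\<close>

lemma pattern_prob_le_power:
  assumes psi: "psi_coeff M \<xi> 1 \<le> ennreal \<eta>" and \<eta>: "0 \<le> \<eta>"
    and G: "G \<in> sets borel" and "finite T"
  defines "p \<equiv> measure (distr M borel (\<xi> 0)) G"
  shows "prob (pattern M \<xi> G T T) \<le> (1 + \<eta>) ^ card T * p ^ card T"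
  using \<open>finite T\<close>
proof (induction T rule: finite_linorder_max_induct)
  case empty
  then show ?case by (simp add: prob_space)
next
  case (insert t T)
  have p0: "p \<ge> 0" by (simp add: p_def)
  let ?U = "insert t T"
  have *: "pattern M \<xi> G T ?U = pattern M \<xi> G T T" "pattern M \<xi> G {t} ?U = pattern M \<xi> G {t} {t}"
    by (intro pattern_cong; blast)+
  have "pattern M \<xi> G ?U ?U = pattern M \<xi> G T ?U \<inter> pattern M \<xi> G {t} ?U"
    using pattern_Un[of M \<xi> G T "{t}" ?U] by simp
  moreover have "\<bar>prob (pattern M \<xi> G T ?U \<inter> pattern M \<xi> G {t} ?U)
      - prob (pattern M \<xi> G T ?U) * prob (pattern M \<xi> G {t} ?U)\<bar>
    \<le> \<eta> * (prob (pattern M \<xi> G T ?U) * prob (pattern M \<xi> G {t} ?U))"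
    using insert.hyps by (intro past_future_bound[OF psi \<eta> G]) auto
  ultimately have "prob (pattern M \<xi> G ?U ?U) \<le> (1 + \<eta>) * (p * prob (pattern M \<xi> G T T))"
    unfolding * pattern_point_prob[OF G] p_def[symmetric] by (simp add: abs_le_iff algebra_simps)
  also have "\<dots> \<le> (1 + \<eta>) * (p * ((1 + \<eta>) ^ card T * p ^ card T))"
    using insert.IH p0 \<eta> by (intro mult_left_mono) auto
  also have "\<dots> = (1 + \<eta>) ^ card ?U * p ^ card ?U"
    using insert.hyps by (subst card_insert_disjoint) auto
  finally show ?case .
qed

lemma exists_small_psi:
  assumes "\<eta> > 0"
  obtains K where "K \<ge> 1" "psi_coeff M \<xi> K \<le> ennreal \<eta>"
proof -
  have "psi_coeff M \<xi> \<longlonglongrightarrow> 0" using mixing by (simp add: psi_mixing_def)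
  then have "\<forall>\<^sub>F n in sequentially. psi_coeff M \<xi> n < ennreal \<eta>"
    using assms by (intro order_tendstoD(2)) auto
  then have "\<forall>\<^sub>F n in sequentially. psi_coeff M \<xi> n < ennreal \<eta> \<and> n \<ge> 1"
    using eventually_ge_at_top by (rule eventually_conj)
  then obtain K where "psi_coeff M \<xi> K < ennreal \<eta>" "K \<ge> 1"
    by (auto dest: eventually_happens)
  then show ?thesis using that by auto
qed

end

section \<open>Counting hits along the array of indices\<close>

text \<open>The assumption \<open>gaps\<close> is the divergence of \<open>min_gap\<close> in elementary form; for \<open>l = 1\<close> it is void.\<close>

locale psi_array = psi_process +
  fixes l :: nat and q :: "nat \<Rightarrow> nat \<Rightarrow> nat"
  assumes l_pos: "l \<ge> 1"
    and strict_mono_q: "\<And>i. i \<in> {1..l} \<Longrightarrow> strict_mono (q i)"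
    and q_less_Suc: "\<And>i n. i \<in> {1..<l} \<Longrightarrow> q i n < q (Suc i) n"
    and gaps: "\<And>K. \<exists>n0. \<forall>n\<ge>n0. \<forall>i\<in>{1..<l}. q i n + K \<le> q (Suc i) n"
begin

definition pts :: "nat \<Rightarrow> nat set" where
  "pts n = (\<lambda>i. q i n) ` {1..l}"

definition occ :: "real set \<Rightarrow> nat \<Rightarrow> 'a set" where
  "occ G n = pattern M \<xi> G (pts n) (pts n)"

lemma finite_pts [simp]: "finite (pts n)"
  by (simp add: pts_def)

lemma occ_event: "G \<in> sets borel \<Longrightarrow> occ G n \<in> events"
  by (simp add: occ_def pattern_event)

lemma q_gap:
  assumes gap: "\<And>i. i \<in> {1..<l} \<Longrightarrow> q i n + K \<le> q (Suc i) n" and "1 \<le> i" "i < j" "j \<le> l"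
  shows "q i n + K \<le> q j n"
  using \<open>i < j\<close> \<open>j \<le> l\<close>
proof (induction j)
  case (Suc j)
  show ?case
  proof (cases "i = j")
    case False
    then have "q i n + K \<le> q j n" using Suc by simp
    also have "\<dots> \<le> q (Suc j) n" using gap[of j] Suc.prems \<open>1 \<le> i\<close> by simp
    finally show ?thesis .
  qed (use gap[of j] Suc.prems \<open>1 \<le> i\<close> in auto)
qed simp

lemma q_less: "1 \<le> i \<Longrightarrow> i < j \<Longrightarrow> j \<le> l \<Longrightarrow> q i n < q j n"
  using q_gap[of n 1 i j] q_less_Suc[of _ n] by (simp add: Suc_le_eq)

lemma card_pts: "card (pts n) = l"
proof -
  have "inj_on (\<lambda>i. q i n) {1..l}"
    by (rule inj_onI) (metis atLeastAtMost_iff less_irrefl nat_neq_iff q_less)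
  then show ?thesis by (simp add: pts_def card_image)
qed

text \<open>For \<open>n < m\<close> the largest index \<open>q l m\<close> of \<open>m\<close> exceeds all indices of \<open>n\<close>. The
other \<open>l - 1\<close> indices of \<open>m\<close> may all occur among those of \<open>n\<close>.\<close>

lemma card_pts_Un:
  assumes "n \<noteq> m"
  shows "l + 1 \<le> card (pts n \<union> pts m)"
proof -
  have *: "l + 1 \<le> card (pts n \<union> pts m)" if "n < m" for n m
  proof -
    have "q i n < q l m" if "i \<in> {1..l}" for i
    proof -
      have "q i n \<le> q l n" using q_less[of i l n] that by (cases "i = l") auto
      also have "\<dots> < q l m" using strict_mono_q[of l] l_pos \<open>n < m\<close> by (auto simp: strict_mono_def)
      finally show ?thesis .
    qed
    then have "q l m \<notin> pts n" by (force simp: pts_def)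
    then have "card (insert (q l m) (pts n)) = l + 1" by (simp add: card_pts)
    moreover have "insert (q l m) (pts n) \<subseteq> pts n \<union> pts m" using l_pos by (auto simp: pts_def)
    ultimately show ?thesis by (metis card_mono finite_UnI finite_pts)
  qed
  show ?thesis using *[of n m] *[of m n] assms by (cases "n < m") (auto simp: Un_commute)
qed

definition law :: "real set \<Rightarrow> real" where
  "law G = measure (distr M borel (\<xi> 0)) G"

lemma law_bounds: "0 \<le> law G" "law G \<le> 1"
proof -
  interpret D: prob_space "distr M borel (\<xi> 0)" by (rule prob_space_distr) simp
  show "0 \<le> law G" "law G \<le> 1" by (simp_all add: law_def)
qed

text \<open>The exponent \<open>2 * l\<close> instead of \<open>l\<close> lets a single constant serve here and in the bound for pairs.\<close>

lemma prob_occ_le: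
  assumes "psi_coeff M \<xi> 1 \<le> ennreal \<eta>" "0 \<le> \<eta>" "G \<in> sets borel"
  shows "prob (occ G n) \<le> (1 + \<eta>) ^ (2 * l) * law G ^ l"
proof -
  have "prob (occ G n) \<le> (1 + \<eta>) ^ l * law G ^ l"
    using pattern_prob_le_power[OF assms, of "pts n"] by (simp add: card_pts occ_def law_def)
  also have "\<dots> \<le> (1 + \<eta>) ^ (2 * l) * law G ^ l"
    using assms law_bounds[of G] by (intro mult_right_mono power_increasing) auto
  finally show ?thesis .
qed

lemma prob_occ_Int_le:
  assumes "psi_coeff M \<xi> 1 \<le> ennreal \<eta>" "0 \<le> \<eta>" "G \<in> sets borel" "n \<noteq> m"
  shows "prob (occ G n \<inter> occ G m) \<le> (1 + \<eta>) ^ (2 * l) * law G ^ (l + 1)"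
proof -
  let ?T = "pts n \<union> pts m"
  have "occ G n \<inter> occ G m = pattern M \<xi> G ?T ?T"
    by (auto simp: occ_def pattern_def)
  then have "prob (occ G n \<inter> occ G m) \<le> (1 + \<eta>) ^ card ?T * law G ^ card ?T"
    using pattern_prob_le_power[OF assms(1-3), of ?T] by (simp add: law_def)
  also have "\<dots> \<le> (1 + \<eta>) ^ (2 * l) * law G ^ (l + 1)"
  proof (rule mult_mono)
    have "card ?T \<le> 2 * l" using card_Un_le[of "pts n" "pts m"] by (simp add: card_pts)
    then show "(1 + \<eta>) ^ card ?T \<le> (1 + \<eta>) ^ (2 * l)"
      using assms by (intro power_increasing) auto
    show "law G ^ card ?T \<le> law G ^ (l + 1)"
      using law_bounds[of G] card_pts_Un[OF assms(4)] by (intro power_decreasing) auto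
  qed (use assms law_bounds[of G] in auto)
  finally show ?thesis .
qed

definition close :: "nat \<Rightarrow> nat \<Rightarrow> nat set" where
  "close K n = {m. \<exists>s\<in>pts n. \<exists>t\<in>pts m. t < s + K \<and> s < t + K}"

text \<open>Each \<open>q j\<close> is injective, so for each pair \<open>(i, j)\<close> at most \<open>2 * K\<close> numbers \<open>m\<close> place \<open>q j m\<close> within
distance \<open>K\<close> of \<open>q i n\<close>.\<close>

lemma finite_close: "finite (close K n)" and card_close: "card (close K n) \<le> 2 * K * l * l"
proof -
  define H where "H i j = q j -` {q i n - K..<q i n + K}" for i j
  have inj: "inj (q j)" if "j \<in> {1..l}" for j
    using strict_mono_q[OF that] by (rule strict_mono_imp_inj_on)
  have sub: "close K n \<subseteq> (\<Union>i\<in>{1..l}. \<Union>j\<in>{1..l}. H i j)"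
  proof
    fix m assume "m \<in> close K n"
    then obtain i j where "i \<in> {1..l}" "j \<in> {1..l}" "q j m < q i n + K" "q i n < q j m + K"
      by (auto simp: close_def pts_def)
    then show "m \<in> (\<Union>i\<in>{1..l}. \<Union>j\<in>{1..l}. H i j)"
      by (intro UN_I[of i] UN_I[of j]) (auto simp: H_def)
  qed
  have finH: "finite (H i j)" if "j \<in> {1..l}" for i j
    unfolding H_def by (intro finite_vimageI inj that) simp
  have cardH: "card (H i j) \<le> 2 * K" if "j \<in> {1..l}" for i j
  proof -
    have "card (H i j) \<le> card {q i n - K..<q i n + K}"
      unfolding H_def using card_vimage_inj_on_le[OF inj[OF that], of "{q i n - K..<q i n + K}"] by simp
    then show ?thesis by simp
  qed
  have fin: "finite (\<Union>i\<in>{1..l}. \<Union>j\<in>{1..l}. H i j)" using finH by auto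
  show "finite (close K n)" using finite_subset[OF sub fin] .
  have "card (close K n) \<le> card (\<Union>i\<in>{1..l}. \<Union>j\<in>{1..l}. H i j)"
    by (rule card_mono[OF fin sub])
  also have "\<dots> \<le> (\<Sum>i\<in>{1..l}. card (\<Union>j\<in>{1..l}. H i j))"
    by (rule card_UN_le) simp
  also have "\<dots> \<le> (\<Sum>i\<in>{1..l}. \<Sum>j\<in>{1..l}. 2 * K)"
    by (intro sum_mono order_trans[OF card_UN_le] cardH) auto
  finally show "card (close K n) \<le> 2 * K * l * l" by (simp add: mult_ac)
qed

lemma prob_split_patterns:
  assumes "finite J" "G \<in> sets borel" "E \<in> events"
  shows "prob (E \<inter> {\<omega> \<in> space M. h {t\<in>J. \<xi> t \<omega> \<in> G}}) =
    (\<Sum>T | T \<subseteq> J \<and> h T. prob (E \<inter> pattern M \<xi> G J T))"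
proof -
  have "E \<inter> {\<omega> \<in> space M. h {t\<in>J. \<xi> t \<omega> \<in> G}} = (\<Union>T\<in>{T. T \<subseteq> J \<and> h T}. E \<inter> pattern M \<xi> G J T)"
    (is "?L = ?R")
  proof
    show "?L \<subseteq> ?R"
    proof
      fix \<omega> assume "\<omega> \<in> ?L"
      then show "\<omega> \<in> ?R"
        by (intro UN_I[of "{t\<in>J. \<xi> t \<omega> \<in> G}"]) (auto simp: pattern_def)
    qed
    show "?R \<subseteq> ?L"
    proof
      fix \<omega> assume "\<omega> \<in> ?R"
      then obtain T where T: "T \<subseteq> J" "h T" "\<omega> \<in> E" "\<omega> \<in> pattern M \<xi> G J T" by auto
      then have "{t\<in>J. \<xi> t \<omega> \<in> G} = T" by (auto simp: pattern_def)
      then show "\<omega> \<in> ?L" using T by (auto simp: pattern_def)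
    qed
  qed
  moreover have "disjoint_family_on (\<lambda>T. E \<inter> pattern M \<xi> G J T) {T. T \<subseteq> J \<and> h T}"
    unfolding disjoint_family_on_def pattern_def by auto
  ultimately show ?thesis
    using assms by (simp only:) (intro finite_measure_finite_Union, auto intro!: pattern_event)
qed

text \<open>The count over \<open>R\<close> is determined by the pattern on the finite set \<open>J\<close> of all indices it involves,
and \<open>J\<close> is far from the points of \<open>n\<close>. For each pattern \<open>pattern_separated_bounds\<close> compares both
the joint probability and \<open>prob (occ G n)\<close> with \<open>law G ^ l\<close>, up to the same factors
\<open>(1 \<plusminus> 5 \<eta>)\<^sup>l\<close>; summing over the patterns with count \<open>k\<close> keeps the error relative.\<close>

lemma occ_decoupling:
  assumes psi: "psi_coeff M \<xi> K \<le> ennreal \<eta>" and \<eta>: "0 \<le> \<eta>" "5 * \<eta> \<le> 1" and K: "K \<ge> 1"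
    and G: "G \<in> sets borel" and gap: "\<And>i. i \<in> {1..<l} \<Longrightarrow> q i n + K \<le> q (Suc i) n"
    and R: "finite R" "R \<inter> close K n = {}"
  defines "\<delta> \<equiv> ((1 + 5 * \<eta>) ^ l - (1 - 5 * \<eta>) ^ l) * law G ^ l"
  shows "\<bar>prob (occ G n) - law G ^ l\<bar> \<le> \<delta>"
    and "\<bar>prob (occ G n \<inter> {\<omega> \<in> space M. hits (occ G) R \<omega> = k})
      - prob (occ G n) * prob {\<omega> \<in> space M. hits (occ G) R \<omega> = k}\<bar>
      \<le> \<delta> * prob {\<omega> \<in> space M. hits (occ G) R \<omega> = k}"
proof -
  define J where "J = (\<Union>m\<in>R. pts m)"
  define a where "a = (1 - 5 * \<eta>) ^ l"
  define b where "b = (1 + 5 * \<eta>) ^ l"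
  define p where "p = law G ^ l"
  have p0: "p \<ge> 0" using law_bounds by (simp add: p_def)
  have a1: "a \<le> 1" unfolding a_def using \<eta> by (intro power_le_one) auto
  have b1: "b \<ge> 1" unfolding b_def using \<eta> by (intro one_le_power) auto
  have finJ: "finite J" using R by (simp add: J_def)
  have sepJ: "s + K \<le> t \<or> t + K \<le> s" if "s \<in> J" "t \<in> pts n" for s t
    using R that by (force simp: J_def close_def not_le)
  have sepn: "s + K \<le> t" if "s \<in> pts n" "t \<in> pts n" "s < t" for s t
  proof -
    obtain i j where ij: "i \<in> {1..l}" "j \<in> {1..l}" "s = q i n" "t = q j n"
      using \<open>s \<in> pts n\<close> \<open>t \<in> pts n\<close> by (auto simp: pts_def)
    then have "i < j" using q_less[of j i n] \<open>s < t\<close> by (cases i j rule: linorder_cases) auto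
    then show ?thesis using ij q_gap[OF gap, of i j] by auto
  qed
  have bounds: "a * (p * prob (pattern M \<xi> G J' T)) \<le> prob (occ G n \<inter> pattern M \<xi> G J' T) \<and>
      prob (occ G n \<inter> pattern M \<xi> G J' T) \<le> b * (p * prob (pattern M \<xi> G J' T))"
    if "J' \<subseteq> J" for T J'
  proof -
    let ?U = "pts n \<union> T"
    have "pts n \<inter> J = {}" using sepJ K by fastforce
    then have "pattern M \<xi> G J' ?U = pattern M \<xi> G J' T" "pattern M \<xi> G (pts n) ?U = occ G n"
      unfolding occ_def using that by (auto intro!: pattern_cong)
    moreover have "(1 - 5 * \<eta>) ^ card (pts n) * (law G ^ card (pts n) * prob (pattern M \<xi> G J' ?U))
        \<le> prob (pattern M \<xi> G (pts n \<union> J') ?U)"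
      unfolding law_def
      by (rule pattern_separated_bounds[OF psi \<eta> K G])
         (use that finJ sepJ sepn in \<open>auto intro: finite_subset\<close>)
    moreover have "prob (pattern M \<xi> G (pts n \<union> J') ?U)
        \<le> (1 + 5 * \<eta>) ^ card (pts n) * (law G ^ card (pts n) * prob (pattern M \<xi> G J' ?U))"
      unfolding law_def
      by (rule pattern_separated_bounds[OF psi \<eta> K G])
         (use that finJ sepJ sepn in \<open>auto intro: finite_subset\<close>)
    ultimately show ?thesis
      by (simp add: pattern_Un card_pts a_def b_def p_def)
  qed
  have "occ G n \<inter> space M = occ G n" by (auto simp: occ_def pattern_def)
  then have occ: "a * p \<le> prob (occ G n)" "prob (occ G n) \<le> b * p"
    using bounds[of "{}" "{}"] by (simp_all add: prob_space)
  have \<delta>: "\<delta> = b * p - a * p" by (simp add: \<delta>_def a_def b_def p_def algebra_simps)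
  have "a * p \<le> p" "p \<le> b * p"
    using a1 b1 p0 mult_right_mono[of a 1 p] mult_right_mono[of 1 b p] by auto
  then show "\<bar>prob (occ G n) - law G ^ l\<bar> \<le> \<delta>"
    using occ unfolding \<delta> p_def[symmetric] by (simp add: abs_le_iff)
  have atom: "\<bar>prob (occ G n \<inter> pattern M \<xi> G J T) - prob (occ G n) * prob (pattern M \<xi> G J T)\<bar>
      \<le> \<delta> * prob (pattern M \<xi> G J T)" for T
  proof -
    let ?x = "prob (pattern M \<xi> G J T)"
    have "a * p * ?x \<le> prob (occ G n) * ?x" "prob (occ G n) * ?x \<le> b * p * ?x"
      using occ by (auto intro: mult_right_mono)
    moreover have "a * p * ?x \<le> prob (occ G n \<inter> pattern M \<xi> G J T)"
        "prob (occ G n \<inter> pattern M \<xi> G J T) \<le> b * p * ?x"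
      using bounds[of J T] by (simp_all add: mult.assoc)
    ultimately show ?thesis unfolding \<delta> by (simp add: abs_le_iff left_diff_distrib)
  qed
  \<comment> \<open>Membership in the event \<open>{hits = k}\<close> as a property of the set of hit indices in \<open>J\<close>.\<close>
  define h where "h T \<longleftrightarrow> card {m\<in>R. pts m \<subseteq> T} = k" for T
  have hk: "{\<omega> \<in> space M. hits (occ G) R \<omega> = k} = {\<omega> \<in> space M. h {t\<in>J. \<xi> t \<omega> \<in> G}}"
  proof (intro Collect_cong conj_cong refl)
    fix \<omega> assume "\<omega> \<in> space M"
    then have "{m\<in>R. \<omega> \<in> occ G m} = {m\<in>R. pts m \<subseteq> {t\<in>J. \<xi> t \<omega> \<in> G}}"
      by (auto simp: occ_def pattern_def J_def)
    then show "(hits (occ G) R \<omega> = k) = h {t\<in>J. \<xi> t \<omega> \<in> G}"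
      by (simp add: hits_def h_def)
  qed
  have E: "prob {\<omega> \<in> space M. hits (occ G) R \<omega> = k} = (\<Sum>T | T \<subseteq> J \<and> h T. prob (pattern M \<xi> G J T))"
  proof -
    have "space M \<inter> pattern M \<xi> G J T = pattern M \<xi> G J T" for T by (auto simp: pattern_def)
    moreover have "space M \<inter> {\<omega> \<in> space M. h {t\<in>J. \<xi> t \<omega> \<in> G}} = {\<omega> \<in> space M. h {t\<in>J. \<xi> t \<omega> \<in> G}}" by auto
    ultimately show ?thesis
      using prob_split_patterns[OF finJ G, of "space M" h] unfolding hk by simp
  qed
  have EA: "prob (occ G n \<inter> {\<omega> \<in> space M. hits (occ G) R \<omega> = k}) =
      (\<Sum>T | T \<subseteq> J \<and> h T. prob (occ G n \<inter> pattern M \<xi> G J T))"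
    unfolding hk by (rule prob_split_patterns[OF finJ G occ_event[OF G]])
  have "\<bar>prob (occ G n \<inter> {\<omega> \<in> space M. hits (occ G) R \<omega> = k})
      - prob (occ G n) * prob {\<omega> \<in> space M. hits (occ G) R \<omega> = k}\<bar> =
    \<bar>\<Sum>T | T \<subseteq> J \<and> h T. prob (occ G n \<inter> pattern M \<xi> G J T) - prob (occ G n) * prob (pattern M \<xi> G J T)\<bar>"
    unfolding E EA by (simp add: sum_subtractf sum_distrib_left)
  also have "\<dots> \<le> (\<Sum>T | T \<subseteq> J \<and> h T. \<delta> * prob (pattern M \<xi> G J T))"
    by (rule order_trans[OF sum_abs]) (intro sum_mono atom)
  also have "\<dots> = \<delta> * prob {\<omega> \<in> space M. hits (occ G) R \<omega> = k}"
    unfolding E by (simp add: sum_distrib_left)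
  finally show "\<bar>prob (occ G n \<inter> {\<omega> \<in> space M. hits (occ G) R \<omega> = k})
      - prob (occ G n) * prob {\<omega> \<in> space M. hits (occ G) R \<omega> = k}\<bar>
      \<le> \<delta> * prob {\<omega> \<in> space M. hits (occ G) R \<omega> = k}" .
qed

text \<open>First fix the accuracy \<open>\<eta>\<close> of the decoupling, then the distance \<open>K\<close> that achieves it, then the
time \<open>n0\<close> from which on the gaps are at least \<open>K\<close>. None of these depends on \<open>G\<close>, \<open>N\<close> or \<open>r\<close>, and
everything that grows with \<open>K\<close> and \<open>n0\<close> ends up in the constant \<open>W\<close>, which multiplies
\<open>law G\<close>.\<close>

lemma poisson_approximation:
  assumes "\<epsilon> > 0"
  shows "\<exists>W\<ge>0. \<forall>G\<in>sets borel. \<forall>N D. \<forall>r>0.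
      \<bar>prob {\<omega> \<in> space M. hits (occ G) {..<N} \<omega> \<in> D} - measure_pmf.prob (poisson_pmf r) D\<bar>
      \<le> exp r * (2 * \<epsilon> * (real N * law G ^ l) + W * (1 + real N * law G ^ l) * law G
          + \<bar>real N * law G ^ l - r\<bar>)"
proof -
  have "((\<lambda>\<eta>::real. (1 + 5 * \<eta>) ^ l - (1 - 5 * \<eta>) ^ l) \<longlongrightarrow> (1 + 5 * 0) ^ l - (1 - 5 * 0) ^ l) (at_right 0)"
    by (intro tendsto_intros)
  then have "\<forall>\<^sub>F \<eta> in at_right 0. (1 + 5 * \<eta>) ^ l - (1 - 5 * \<eta>) ^ l < \<epsilon>"
    using assms by (intro order_tendstoD(2)) auto
  moreover have "\<forall>\<^sub>F \<eta>::real in at_right 0. \<eta> \<in> {0<..<1/5}"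
    by (rule eventually_at_right_real) simp
  ultimately have "\<forall>\<^sub>F \<eta> in at_right 0. (1 + 5 * \<eta>) ^ l - (1 - 5 * \<eta>) ^ l < \<epsilon> \<and> \<eta> \<in> {0<..<1/5}"
    by (rule eventually_conj)
  then obtain \<eta> :: real where "(1 + 5 * \<eta>) ^ l - (1 - 5 * \<eta>) ^ l < \<epsilon> \<and> \<eta> \<in> {0<..<1/5}"
    using eventually_happens[of _ "at_right (0::real)"] by (auto simp: trivial_limit_at_right_real)
  then have \<eta>: "0 < \<eta>" "5 * \<eta> \<le> 1" "(1 + 5 * \<eta>) ^ l - (1 - 5 * \<eta>) ^ l \<le> \<epsilon>" by auto
  obtain K where K: "K \<ge> 1" "psi_coeff M \<xi> K \<le> ennreal \<eta>"
    using exists_small_psi[OF \<eta>(1)] .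
  obtain n0 where n0: "\<And>n i. n \<ge> n0 \<Longrightarrow> i \<in> {1..<l} \<Longrightarrow> q i n + K \<le> q (Suc i) n"
    using gaps[of K] by blast
  define \<psi> where "\<psi> = enn2real (psi_coeff M \<xi> 1)"
  have \<psi>: "psi_coeff M \<xi> 1 \<le> ennreal \<psi>" "0 \<le> \<psi>"
    using mixing by (auto simp: \<psi>_def psi_mixing_def)
  define c where "c = (1 + \<psi>) ^ (2 * l)"
  have c1: "c \<ge> 1" unfolding c_def using \<psi> by (intro one_le_power) auto
  define Z where "Z = n0 + 2 * K * l * l"
  define W where "W = 2 * c * Z + 2 * c * c * Z + n0 * (c + 1)"
  have W0: "W \<ge> 0" using c1 by (simp add: W_def)
  show ?thesis
  proof (intro exI[of _ W] conjI W0 ballI allI impI)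
    fix G :: "real set" and N :: nat and r :: real and D :: "nat set"
    assume G: "G \<in> sets borel" and r: "r > 0"
    define p where "p = law G"
    have p: "0 \<le> p" "p \<le> 1" using law_bounds by (auto simp: p_def)
    \<comment> \<open>The first \<open>n0\<close> events, whose indices may be close together, have all of \<open>{..<N}\<close> as neighbourhood: the count outside is then constant.\<close>
    define B where "B n = (if n < n0 then {..<N} else {..<N} \<inter> close K n)" for n
    define \<delta> where "\<delta> n = (if n < n0 then 0 else \<epsilon> * p ^ l)" for n
    have finB: "finite (B n)" for n by (simp add: B_def)
    have far: "\<bar>prob (occ G n) - p ^ l\<bar> \<le> \<epsilon> * p ^ l"
      "\<bar>prob (occ G n \<inter> {\<omega> \<in> space M. hits (occ G) R \<omega> = k})
        - prob (occ G n) * prob {\<omega> \<in> space M. hits (occ G) R \<omega> = k}\<bar>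
        \<le> \<epsilon> * p ^ l * prob {\<omega> \<in> space M. hits (occ G) R \<omega> = k}"
      if "n0 \<le> n" "finite R" "R \<inter> close K n = {}" for n R k
    proof -
      have le: "((1 + 5 * \<eta>) ^ l - (1 - 5 * \<eta>) ^ l) * p ^ l \<le> \<epsilon> * p ^ l"
        using \<eta> p by (intro mult_right_mono) auto
      show "\<bar>prob (occ G n) - p ^ l\<bar> \<le> \<epsilon> * p ^ l"
        using occ_decoupling(1)[OF K(2) _ \<eta>(2) K(1) G n0[OF that(1)] that(2,3)] \<eta>(1) le
        unfolding p_def by linarith
      have "\<bar>prob (occ G n \<inter> {\<omega> \<in> space M. hits (occ G) R \<omega> = k})
        - prob (occ G n) * prob {\<omega> \<in> space M. hits (occ G) R \<omega> = k}\<bar>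
        \<le> ((1 + 5 * \<eta>) ^ l - (1 - 5 * \<eta>) ^ l) * p ^ l * prob {\<omega> \<in> space M. hits (occ G) R \<omega> = k}"
        using occ_decoupling(2)[OF K(2) _ \<eta>(2) K(1) G n0[OF that(1)] that(2,3)] \<eta>(1)
        unfolding p_def by auto
      also have "\<dots> \<le> \<epsilon> * p ^ l * prob {\<omega> \<in> space M. hits (occ G) R \<omega> = k}"
        by (intro mult_right_mono le) simp
      finally show "\<bar>prob (occ G n \<inter> {\<omega> \<in> space M. hits (occ G) R \<omega> = k})
        - prob (occ G n) * prob {\<omega> \<in> space M. hits (occ G) R \<omega> = k}\<bar>
        \<le> \<epsilon> * p ^ l * prob {\<omega> \<in> space M. hits (occ G) R \<omega> = k}" .
    qed
    have one: "prob (occ G n) \<le> c * p ^ l" for n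
      unfolding c_def p_def by (rule prob_occ_le[OF \<psi> G])
    have two: "prob (occ G n \<inter> occ G m) \<le> c * p ^ (l + 1)" if "n \<noteq> m" for n m
      unfolding c_def p_def by (rule prob_occ_Int_le[OF \<psi> G that])
    have cardB: "(\<Sum>n<N. real (card (B n))) \<le> real N * Z"
    proof -
      have "card (B n) \<le> 2 * K * l * l + (if n < n0 then N else 0)" for n
      proof -
        have "card ({..<N} \<inter> close K n) \<le> card (close K n)"
          by (intro card_mono finite_close) auto
        then show ?thesis using card_close[of K n] by (simp add: B_def)
      qed
      then have "(\<Sum>n<N. card (B n)) \<le> (\<Sum>n<N. 2 * K * l * l + (if n < n0 then N else 0))"
        by (rule sum_mono)
      also have "\<dots> = N * (2 * K * l * l) + N * card ({..<N} \<inter> {n. n < n0})"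
        by (simp add: sum.distrib sum.If_cases)
      also have "card ({..<N} \<inter> {n. n < n0}) \<le> card {..<n0}"
        by (intro card_mono) auto
      finally have "(\<Sum>n<N. card (B n)) \<le> N * Z"
        by (simp add: Z_def algebra_simps)
      then show ?thesis by (metis of_nat_le_iff of_nat_mult of_nat_sum)
    qed
    have first: "(\<Sum>n<N. \<Sum>m\<in>B n - {n}. prob (occ G n \<inter> occ G m)) \<le> c * Z * (real N * p ^ l) * p"
    proof -
      have "(\<Sum>n<N. \<Sum>m\<in>B n - {n}. prob (occ G n \<inter> occ G m)) \<le> (\<Sum>n<N. \<Sum>m\<in>B n - {n}. c * p ^ (l + 1))"
        by (intro sum_mono two) auto
      also have "\<dots> \<le> (\<Sum>n<N. \<Sum>m\<in>B n. c * p ^ (l + 1))"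
        using c1 p finB by (intro sum_mono sum_mono2) auto
      also have "\<dots> = (\<Sum>n<N. real (card (B n))) * (c * p ^ (l + 1))"
        by (simp add: sum_distrib_right)
      also have "\<dots> \<le> real N * Z * (c * p ^ (l + 1))"
        using c1 p by (intro mult_right_mono cardB) auto
      finally show ?thesis by (simp add: mult_ac)
    qed
    have second: "(\<Sum>n<N. \<Sum>m\<in>B n. prob (occ G n) * prob (occ G m)) \<le> c * c * Z * (real N * p ^ l) * p"
    proof -
      have pl: "p ^ l \<le> p" using p l_pos power_decreasing[of 1 l p] by simp
      have "prob (occ G n) * prob (occ G m) \<le> c * c * p ^ (l + 1)" for n m
      proof -
        have "prob (occ G n) * prob (occ G m) \<le> (c * p ^ l) * (c * p ^ l)"
          using c1 p by (intro mult_mono one) auto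
        also have "\<dots> \<le> (c * p ^ l) * (c * p)"
          using c1 p pl by (intro mult_left_mono) auto
        finally show ?thesis by (simp add: mult_ac)
      qed
      then have "(\<Sum>n<N. \<Sum>m\<in>B n. prob (occ G n) * prob (occ G m)) \<le> (\<Sum>n<N. \<Sum>m\<in>B n. c * c * p ^ (l + 1))"
        by (intro sum_mono)
      also have "\<dots> = (\<Sum>n<N. real (card (B n))) * (c * c * p ^ (l + 1))"
        by (simp add: sum_distrib_right)
      also have "\<dots> \<le> real N * Z * (c * c * p ^ (l + 1))"
        using c1 p by (intro mult_right_mono cardB) auto
      finally show ?thesis by (simp add: mult_ac)
    qed
    have third: "(\<Sum>n<N. \<delta> n) \<le> \<epsilon> * (real N * p ^ l)"
    proof -
      have "(\<Sum>n<N. \<delta> n) \<le> (\<Sum>n<N. \<epsilon> * p ^ l)"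
        using assms p by (intro sum_mono) (auto simp: \<delta>_def)
      then show ?thesis by (simp add: mult_ac)
    qed
    have mean: "\<bar>(\<Sum>n<N. prob (occ G n)) - r\<bar> \<le> \<epsilon> * (real N * p ^ l) + n0 * (c + 1) * p + \<bar>real N * p ^ l - r\<bar>"
    proof -
      have "\<bar>prob (occ G n) - p ^ l\<bar> \<le> \<epsilon> * p ^ l + (if n < n0 then (c + 1) * p else 0)" for n
      proof (cases "n < n0")
        case True
        have pl: "p ^ l \<le> p" using p l_pos power_decreasing[of 1 l p] by simp
        have "\<bar>prob (occ G n) - p ^ l\<bar> \<le> prob (occ G n) + p ^ l"
          using p by (simp add: abs_le_iff)
        also have "\<dots> \<le> (c + 1) * p ^ l" using one[of n] by (simp add: algebra_simps)
        also have "\<dots> \<le> (c + 1) * p" using pl c1 by (intro mult_left_mono) auto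
        finally show ?thesis using True assms p by (simp add: add_increasing)
      next
        case False
        then show ?thesis using far(1)[of n "{}"] by simp
      qed
      then have "(\<Sum>n<N. \<bar>prob (occ G n) - p ^ l\<bar>) \<le> (\<Sum>n<N. \<epsilon> * p ^ l + (if n < n0 then (c + 1) * p else 0))"
        by (rule sum_mono)
      also have "\<dots> = \<epsilon> * (real N * p ^ l) + card ({..<N} \<inter> {n. n < n0}) * ((c + 1) * p)"
        by (simp add: sum.distrib sum.If_cases mult_ac)
      also have "\<dots> \<le> \<epsilon> * (real N * p ^ l) + n0 * ((c + 1) * p)"
      proof -
        have "card ({..<N} \<inter> {n. n < n0}) \<le> card {..<n0}" by (intro card_mono) auto
        then show ?thesis using c1 p by (intro add_left_mono mult_right_mono) auto
      qed
      finally have *: "(\<Sum>n<N. \<bar>prob (occ G n) - p ^ l\<bar>) \<le> \<epsilon> * (real N * p ^ l) + n0 * (c + 1) * p"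
        by (simp add: mult_ac)
      have "(\<Sum>n<N. prob (occ G n)) - r = (\<Sum>n<N. prob (occ G n) - p ^ l) + (real N * p ^ l - r)"
        by (simp add: sum_subtractf)
      then have "\<bar>(\<Sum>n<N. prob (occ G n)) - r\<bar> \<le> \<bar>\<Sum>n<N. prob (occ G n) - p ^ l\<bar> + \<bar>real N * p ^ l - r\<bar>"
        by linarith
      also have "\<bar>\<Sum>n<N. prob (occ G n) - p ^ l\<bar> \<le> (\<Sum>n<N. \<bar>prob (occ G n) - p ^ l\<bar>)"
        by (rule sum_abs)
      finally show ?thesis using * by linarith
    qed
    have "\<bar>prob {\<omega> \<in> space M. hits (occ G) {..<N} \<omega> \<in> D} - measure_pmf.prob (poisson_pmf r) D\<bar>
      \<le> exp r * (2 * (\<Sum>n<N. \<Sum>m\<in>B n - {n}. prob (occ G n \<inter> occ G m))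
        + 2 * (\<Sum>n<N. \<Sum>m\<in>B n. prob (occ G n) * prob (occ G m))
        + (\<Sum>n<N. \<delta> n) + \<bar>(\<Sum>n<N. prob (occ G n)) - r\<bar>)"
    proof (rule chen_stein_bound)
      fix n assume n: "n \<in> {..<N}"
      show "n \<in> B n"
      proof -
        have "q 1 n \<in> pts n" using l_pos by (auto simp: pts_def)
        then have "n \<in> close K n" using K(1) unfolding close_def by (intro CollectI bexI[of _ "q 1 n"]) auto
        then show ?thesis using n by (simp add: B_def)
      qed
      fix k
      show "\<bar>prob (occ G n \<inter> {\<omega> \<in> space M. hits (occ G) ({..<N} - B n) \<omega> = k})
          - prob (occ G n) * prob {\<omega> \<in> space M. hits (occ G) ({..<N} - B n) \<omega> = k}\<bar>
          \<le> \<delta> n * prob {\<omega> \<in> space M. hits (occ G) ({..<N} - B n) \<omega> = k}"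
      proof (cases "n < n0")
        case True
        have "occ G n \<inter> space M = occ G n" by (auto simp: occ_def pattern_def)
        then show ?thesis using True by (cases "k = 0") (simp_all add: B_def \<delta>_def hits_def prob_space)
      next
        case False
        then show ?thesis
          using far(2)[of n "{..<N} - B n" k] by (auto simp: B_def \<delta>_def)
      qed
    qed (use r G in \<open>auto simp: occ_event B_def\<close>)
    also have "\<dots> \<le> exp r * (2 * (c * Z * (real N * p ^ l) * p) + 2 * (c * c * Z * (real N * p ^ l) * p)
        + \<epsilon> * (real N * p ^ l) + (\<epsilon> * (real N * p ^ l) + n0 * (c + 1) * p + \<bar>real N * p ^ l - r\<bar>))"
      using first second third mean by (intro mult_left_mono add_mono) auto
    also have "\<dots> \<le> exp r * (2 * \<epsilon> * (real N * p ^ l) + W * (1 + real N * p ^ l) * p + \<bar>real N * p ^ l - r\<bar>)"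
    proof (intro mult_left_mono)
      define X where "X = real N * p ^ l"
      have X0: "X \<ge> 0" using p by (simp add: X_def)
      have "W * (1 + X) * p = 2 * (c * Z * X * p) + 2 * (c * c * Z * X * p) + n0 * (c + 1) * p
          + (2 * (c * Z * p) + 2 * (c * c * Z * p) + n0 * (c + 1) * p * X)"
        by (simp add: W_def algebra_simps)
      moreover have "0 \<le> 2 * (c * Z * p) + 2 * (c * c * Z * p) + n0 * (c + 1) * p * X"
        using c1 p X0 by (intro add_nonneg_nonneg mult_nonneg_nonneg) auto
      ultimately show "2 * (c * Z * (real N * p ^ l) * p) + 2 * (c * c * Z * (real N * p ^ l) * p)
        + \<epsilon> * (real N * p ^ l) + (\<epsilon> * (real N * p ^ l) + n0 * (c + 1) * p + \<bar>real N * p ^ l - r\<bar>)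
        \<le> 2 * \<epsilon> * (real N * p ^ l) + W * (1 + real N * p ^ l) * p + \<bar>real N * p ^ l - r\<bar>"
        unfolding X_def[symmetric] by linarith
    qed simp
    finally show "\<bar>prob {\<omega> \<in> space M. hits (occ G) {..<N} \<omega> \<in> D} - measure_pmf.prob (poisson_pmf r) D\<bar>
      \<le> exp r * (2 * \<epsilon> * (real N * law G ^ l) + W * (1 + real N * law G ^ l) * law G
          + \<bar>real N * law G ^ l - r\<bar>)"
      unfolding p_def .
  qed
qed

section \<open>Convergence in total variation\<close>

lemma S_sum_eq_hits:
  assumes "\<omega> \<in> space M"
  shows "S_sum \<xi> l q \<Gamma> N \<omega> = real (hits (occ (\<Gamma> N)) {..<N} \<omega>)"
proof -
  have "X_prod \<xi> l q (\<Gamma> N) n \<omega> = indicator (occ (\<Gamma> N) n) \<omega>" for n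
  proof (cases "\<omega> \<in> occ (\<Gamma> N) n")
    case True
    then show ?thesis by (auto simp: X_prod_def occ_def pattern_def pts_def intro!: prod.neutral)
  next
    case False
    then obtain i where "i \<in> {1..l}" "\<xi> (q i n) \<omega> \<notin> \<Gamma> N"
      using assms by (auto simp: occ_def pattern_def pts_def)
    then show ?thesis using False by (auto simp: X_prod_def intro!: prod_zero bexI[of _ i])
  qed
  then show ?thesis by (simp add: S_sum_def hits_eq_sum)
qed

text \<open>The nonnegativity of \<open>dTV\<close> needs the supremum to be bounded; \<open>u\<close> provides the bound.\<close>

lemma dTV_S_sum_le:
  assumes G: "\<Gamma> N \<in> sets borel"
    and le: "\<And>D. \<bar>prob {\<omega> \<in> space M. hits (occ (\<Gamma> N)) {..<N} \<omega> \<in> D} - measure_pmf.prob (poisson_pmf r) D\<bar> \<le> u"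
  shows "0 \<le> dTV (distr M borel (S_sum \<xi> l q \<Gamma> N)) (Pois r)"
    and "dTV (distr M borel (S_sum \<xi> l q \<Gamma> N)) (Pois r) \<le> u"
proof -
  let ?S = "S_sum \<xi> l q \<Gamma> N"
  have [measurable]: "hits (occ (\<Gamma> N)) {..<N} \<in> measurable M (count_space UNIV)"
    using G by (intro measurable_hits) (auto simp: occ_event)
  have S: "?S \<in> borel_measurable M"
    by (subst measurable_cong[OF S_sum_eq_hits]) measurable
  have each: "\<bar>measure (distr M borel ?S) H - measure (Pois r) H\<bar> \<le> u" if "H \<in> sets borel" for H
  proof -
    have "measure (distr M borel ?S) H = prob {\<omega> \<in> space M. hits (occ (\<Gamma> N)) {..<N} \<omega> \<in> real -` H}"
      using that S by (subst measure_distr) (auto simp: S_sum_eq_hits intro!: arg_cong[where f = prob])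
    moreover have "measure (Pois r) H = measure_pmf.prob (poisson_pmf r) (real -` H)"
      using that by (simp add: Pois_def measure_distr)
    ultimately show ?thesis using le[of "real -` H"] by (simp only:)
  qed
  then show "dTV (distr M borel ?S) (Pois r) \<le> u"
    unfolding dTV_def by (intro cSUP_least) auto
  have "\<bar>measure (distr M borel ?S) {} - measure (Pois r) {}\<bar> \<le> dTV (distr M borel ?S) (Pois r)"
    unfolding dTV_def using each by (intro cSUP_upper bdd_aboveI2[where M = u]) auto
  then show "0 \<le> dTV (distr M borel ?S) (Pois r)" by simp
qed

text \<open>The parameters \<open>\<mu> N\<close> need only differ from \<open>N * law (\<Gamma> N) ^ l\<close> by a null sequence. Taking them
equal to it, or constantly equal to its limit if there is one, yields the two halves of the final theorem, without
comparing two Poisson distributions.\<close>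

lemma dTV_tendsto_zero:
  fixes \<mu> :: "nat \<Rightarrow> real"
  assumes \<Gamma>: "\<And>N. N \<ge> 1 \<Longrightarrow> \<Gamma> N \<in> sets borel"
    and bound: "\<And>N. N \<ge> 1 \<Longrightarrow> real N * law (\<Gamma> N) ^ l \<le> C"
    and \<mu>: "\<And>N. N \<ge> 1 \<Longrightarrow> 0 < \<mu> N \<and> \<mu> N \<le> C"
    and lim: "(\<lambda>N. real N * law (\<Gamma> N) ^ l - \<mu> N) \<longlonglongrightarrow> 0"
  shows "(\<lambda>N. dTV (distr M borel (S_sum \<xi> l q \<Gamma> N)) (Pois (\<mu> N))) \<longlonglongrightarrow> 0"
proof (rule LIMSEQ_I)
  fix e :: real assume "e > 0"
  have C: "C > 0" using \<mu>[of 1] by linarith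
  \<comment> \<open>With this choice the part of the error that does not vanish with \<open>N\<close>, \<open>exp C * 2 * \<epsilon> * C\<close>, is \<open>e / 2\<close>.\<close>
  define \<epsilon> where "\<epsilon> = e / (4 * C * exp C)"
  have \<epsilon>: "\<epsilon> > 0" using \<open>e > 0\<close> C by (simp add: \<epsilon>_def)
  obtain W where W: "W \<ge> 0" "\<forall>G\<in>sets borel. \<forall>N D. \<forall>r>0.
      \<bar>prob {\<omega> \<in> space M. hits (occ G) {..<N} \<omega> \<in> D} - measure_pmf.prob (poisson_pmf r) D\<bar>
      \<le> exp r * (2 * \<epsilon> * (real N * law G ^ l) + W * (1 + real N * law G ^ l) * law G
          + \<bar>real N * law G ^ l - r\<bar>)"
    using poisson_approximation[OF \<epsilon>] by blast
  define u where "u N = exp C * (2 * \<epsilon> * C + W * (1 + C) * law (\<Gamma> N) + \<bar>real N * law (\<Gamma> N) ^ l - \<mu> N\<bar>)" for N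
  have bounds: "0 \<le> dTV (distr M borel (S_sum \<xi> l q \<Gamma> N)) (Pois (\<mu> N)) \<and>
      dTV (distr M borel (S_sum \<xi> l q \<Gamma> N)) (Pois (\<mu> N)) \<le> u N" if N: "N \<ge> 1" for N
  proof -
    have "\<bar>prob {\<omega> \<in> space M. hits (occ (\<Gamma> N)) {..<N} \<omega> \<in> D} - measure_pmf.prob (poisson_pmf (\<mu> N)) D\<bar> \<le> u N" for D
    proof -
      have "\<bar>prob {\<omega> \<in> space M. hits (occ (\<Gamma> N)) {..<N} \<omega> \<in> D} - measure_pmf.prob (poisson_pmf (\<mu> N)) D\<bar>
        \<le> exp (\<mu> N) * (2 * \<epsilon> * (real N * law (\<Gamma> N) ^ l) + W * (1 + real N * law (\<Gamma> N) ^ l) * law (\<Gamma> N)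
          + \<bar>real N * law (\<Gamma> N) ^ l - \<mu> N\<bar>)"
        using W(2) \<Gamma>[OF N] \<mu>[OF N] by blast
      also have "exp (\<mu> N) * (2 * \<epsilon> * (real N * law (\<Gamma> N) ^ l) + W * (1 + real N * law (\<Gamma> N) ^ l) * law (\<Gamma> N)
          + \<bar>real N * law (\<Gamma> N) ^ l - \<mu> N\<bar>) \<le> u N"
        unfolding u_def using \<mu>[OF N] bound[OF N] \<epsilon> W(1) C law_bounds[of "\<Gamma> N"]
        by (intro mult_mono add_mono mult_left_mono mult_right_mono order_refl add_left_mono add_nonneg_nonneg mult_nonneg_nonneg) auto
      finally show ?thesis .
    qed
    then show ?thesis using dTV_S_sum_le[where \<Gamma> = \<Gamma> and N = N, OF \<Gamma>[OF N]] by blast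
  qed
  have "(\<lambda>N. law (\<Gamma> N) ^ l) \<longlonglongrightarrow> 0"
  proof (rule tendsto_sandwich[where f = "\<lambda>_. 0" and h = "\<lambda>N. C / real N"])
    show "\<forall>\<^sub>F N in sequentially. law (\<Gamma> N) ^ l \<le> C / real N"
      using bound by (intro eventually_sequentiallyI[of 1]) (simp add: field_simps)
    show "(\<lambda>N. C / real N) \<longlonglongrightarrow> 0" by (rule lim_const_over_n)
  qed (use law_bounds in auto)
  then have "(\<lambda>N. root l (law (\<Gamma> N) ^ l)) \<longlonglongrightarrow> root l 0"
    by (rule tendsto_real_root)
  then have law0: "(\<lambda>N. law (\<Gamma> N)) \<longlonglongrightarrow> 0"
    using l_pos law_bounds by (simp add: real_root_power_cancel)
  have "u \<longlonglongrightarrow> exp C * (2 * \<epsilon> * C + W * (1 + C) * 0 + \<bar>0\<bar>)"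
    unfolding u_def by (intro tendsto_intros law0 lim)
  moreover have "exp C * (2 * \<epsilon> * C + W * (1 + C) * 0 + \<bar>0\<bar>) < e"
    using \<open>e > 0\<close> C by (simp add: \<epsilon>_def field_simps)
  ultimately have "\<forall>\<^sub>F N in sequentially. u N < e" by (rule order_tendstoD(2))
  then obtain N1 where "\<And>N. N \<ge> N1 \<Longrightarrow> u N < e" by (auto simp: eventually_sequentially)
  then show "\<exists>N1. \<forall>N\<ge>N1. norm (dTV (distr M borel (S_sum \<xi> l q \<Gamma> N)) (Pois (\<mu> N)) - 0) < e"
    using bounds by (intro exI[of _ "max N1 1"]) (force simp: abs_less_iff)
qed

end

lemma min_gap_tendsto_infinity_imp:
  assumes "min_gap l q \<longlonglongrightarrow> \<infinity>"
  shows "\<exists>n0. \<forall>n\<ge>n0. \<forall>i\<in>{1..<l}. q i n + K \<le> q (Suc i) n"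
proof -
  have "\<forall>\<^sub>F n in sequentially. enat K < min_gap l q n"
    using assms by (rule order_tendstoD(1)) simp
  then obtain n0 where n0: "enat K < min_gap l q n0"
    by (auto dest: eventually_happens)
  have "q i n + K \<le> q (Suc i) n" if "n \<ge> n0" "i \<in> {1..<l}" for n i
  proof -
    have "min_gap l q n0 \<le> (INF i\<in>{1..l - 1}. enat (q (i + 1) n - q i n))"
      unfolding min_gap_def using that by (intro INF_lower) auto
    also have "\<dots> \<le> enat (q (i + 1) n - q i n)"
      using that by (intro INF_lower) auto
    finally have "enat K < enat (q (i + 1) n - q i n)" using n0 by (rule less_le_trans[rotated])
    then show ?thesis by simp
  qed
  then show ?thesis by blast
qed

theorem corollary2p4:
  fixes M :: "'a measure" and \<xi> :: "nat \<Rightarrow> 'a \<Rightarrow> real"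
    and l :: nat and q :: "nat \<Rightarrow> nat \<Rightarrow> nat"
    and \<Gamma> :: "nat \<Rightarrow> real set" and C :: real
    and Q :: "real measure" and lam :: "nat \<Rightarrow> real"
  assumes "prob_space M" and "complete_measure M"
    and "stationary_process M \<xi>" and "psi_mixing M \<xi>"
    and "l \<ge> 1"
    and "\<And>i. i \<in> {1..l} \<Longrightarrow> strict_mono (q i)"
    and "\<And>i n. i \<in> {1..<l} \<Longrightarrow> q i n < q (i + 1) n"
    and "min_gap l q \<longlonglongrightarrow> \<infinity>"
    and "Q = distr M borel (\<xi> 0)"
    and "\<And>N. N \<ge> 1 \<Longrightarrow> \<Gamma> N \<in> sets borel"
    and "\<And>N. lam N = real N * measure Q (\<Gamma> N) ^ l"
    and "0 < inverse C"
    and "\<And>N. N \<ge> 1 \<Longrightarrow> inverse C \<le> lam N \<and> lam N \<le> C"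
  shows "(\<lambda>N. dTV (distr M borel (S_sum \<xi> l q \<Gamma> N)) (Pois (lam N))) \<longlonglongrightarrow> 0
    \<and> (\<forall>r. lam \<longlonglongrightarrow> r \<longrightarrow> (\<lambda>N. dTV (distr M borel (S_sum \<xi> l q \<Gamma> N)) (Pois r)) \<longlonglongrightarrow> 0)"
proof -
  interpret prob_space M by fact
  interpret psi_array M \<xi> l q
    using assms(3-7) min_gap_tendsto_infinity_imp[OF assms(8)] by unfold_locales auto
  have lam: "real N * law (\<Gamma> N) ^ l = lam N" for N
    by (simp add: assms(9,11) law_def)
  have lam_pos: "0 < lam N" if "N \<ge> 1" for N
    using assms(12) assms(13)[OF that] by linarith
  have part1: "(\<lambda>N. dTV (distr M borel (S_sum \<xi> l q \<Gamma> N)) (Pois (lam N))) \<longlonglongrightarrow> 0"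
    using lam_pos assms(10,13) by (intro dTV_tendsto_zero[where C = C]) (auto simp: lam)
  have part2: "(\<lambda>N. dTV (distr M borel (S_sum \<xi> l q \<Gamma> N)) (Pois r)) \<longlonglongrightarrow> 0" if "lam \<longlonglongrightarrow> r" for r
  proof -
    have "inverse C \<le> r"
      using assms(13) by (intro LIMSEQ_le_const[OF that] exI[of _ 1]) auto
    then have "0 < r" using assms(12) by linarith
    moreover have "r \<le> C"
      using assms(13) by (intro LIMSEQ_le_const2[OF that] exI[of _ 1]) auto
    moreover have "(\<lambda>N. lam N - r) \<longlonglongrightarrow> 0"
      using that by (simp add: LIM_zero)
    ultimately show ?thesis
      using assms(10,12,13) by (intro dTV_tendsto_zero[where C = C]) (auto simp: lam)
  qed
  from part1 part2 show ?thesis by blast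
qed

end
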